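(* For the fiberwise convex domains $M_R^c$ and $M_H^{c'}$ in $T^*S^2$ defined by the regularized energy hypersurfaces of the rotating Kepler problem and Hill's lunar problem, the following inclusions hold in $T^*S^2$. (1) $M_H^{c}\subset M_R^{c_R^1}$ for all $c\ge c_H^0$. (2) For all $P=2,3,4,\dots$: $M_H^{c}\subset M_R^{c_R^P}$ if $c\ge c_H^P$. (3) $M_R^{c+\frac{1}{2c^2}}\subset M_H^c$ for all $c>c_H^0$.
   Context: On $T^*(\mathbb{R}^2\setminus\{0\})$ with coordinates $(q,p)$ and symplectic form $dp\wedge dq$ let $$H_R(q,p)=\tfrac12|p|^2-\tfrac1{|q|}+p_1q_2-p_2q_1,\qquad H_H(q,p)=H_R(q,p)-q_1^2+\tfrac12q_2^2$$ be the Hamiltonians of the rotating Kepler problem and of Hill's lunar problem. Their unique critical values are $-c_R^0=-\frac32$ and $-c_H^0=-\frac{3^{4/3}}{2}$. Let $\Psi(q,p)=(p,-q)$ and let $\Phi:T^*\mathbb{R}^2\to T^*(S^2\setminus\{\text{north pole}\})$ be the cotangent lift (symplectomorphism) of the inverse stereographic projection $\phi(x_1,x_2)=\frac{1}{|x|^2+1}(2x_1,2x_2,|x|^2-1)$; so under $\Phi\circ\Psi$ the momentum $p$ gives the base point and $-q$ the fiber coordinate. For $c>c_R^0$ (resp. $c>c_H^0$), $\Sigma_R^c$ (resp. $\Sigma_H^c$) is the bounded component of the closure in $T^*S^2$ of $\Phi\circ\Psi(H_R^{-1}(-c))$ (resp. $\Phi\circ\Psi(H_H^{-1}(-c))$).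 It is known that these are fiberwise convex hypersurfaces of $T^*S^2$ (each intersection with a cotangent fiber bounds a strictly convex bounded domain containing the origin). $M_R^c$, $M_H^c$ are the compact domains they bound. For $c=c_H^0$, $M_H^{c_H^0}$ denotes the limiting domain, i.e. the closure of $\bigcup_{c>c_H^0}M_H^c$. For $P=1,2,3,\dots$: $$c_R^P:=\frac{P+3}{2(P+1)^{1/3}},\qquad c_H^P:=\frac{2P+8-\sqrt{(P+1)(P+9)}}{2(P+1)^{1/3}}.$$ *)

theory Defs
  imports "HOL-Analysis.Analysis"
begin

definition H_R :: "real^2 \<Rightarrow> real^2 \<Rightarrow> real" where
  "H_R q p = (norm p)\<^sup>2 / 2 - 1 / norm q + p$1 * q$2 - p$2 * q$1"

definition H_H :: "real^2 \<Rightarrow> real^2 \<Rightarrow> real" where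
  "H_H q p = H_R q p - (q$1)\<^sup>2 + (q$2)\<^sup>2 / 2"

(* A covector at x on the sphere is represented, through the inner product of the ambient
   space, by a vector y orthogonal to x.  The fibre norm is then the round norm, and
   boundedness in the ambient space is boundedness in the fibre direction. *)
definition TS2 :: "((real^3) \<times> (real^3)) set" where
  "TS2 = {(x, y). norm x = 1 \<and> y \<bullet> x = 0}"

lemma closed_TS2: "closed TS2"
proof -
  have eq: "TS2 = {z. norm (fst z) = 1} \<inter> {z. snd z \<bullet> fst z = 0}"
    by (auto simp: TS2_def)
  have "closed {z :: (real^3) \<times> (real^3). norm (fst z) = 1}"
    by (intro closed_Collect_eq continuous_intros)
  moreover have "closed {z :: (real^3) \<times> (real^3). snd z \<bullet> fst z = 0}"
    by (intro closed_Collect_eq continuous_intros)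
  ultimately show ?thesis
    unfolding eq by (rule closed_Int)
qed

definition Psi :: "(real^2) \<times> (real^2) \<Rightarrow> (real^2) \<times> (real^2)" where
  "Psi = (\<lambda>(q, p). (p, - q))"

definition stereo_inv :: "real^2 \<Rightarrow> real^3" where
  "stereo_inv x = (1 / ((norm x)\<^sup>2 + 1)) *\<^sub>R vector [2 * x$1, 2 * x$2, (norm x)\<^sup>2 - 1]"

(* Cotangent lift of stereo_inv: the covector y at x goes to the unique covector eta at
   stereo_inv x whose pullback along the differential of stereo_inv at x is y. *)
definition Phi :: "(real^2) \<times> (real^2) \<Rightarrow> (real^3) \<times> (real^3)" where
  "Phi = (\<lambda>(x, y). (stereo_inv x,
     THE \<eta>. \<eta> \<bullet> stereo_inv x = 0 \<and>
       (\<forall>v. \<eta> \<bullet> frechet_derivative stereo_inv (at x) v = y \<bullet> v)))"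

(* The guard q \<noteq> 0 is needed because 1 / norm 0 = 0.  As TS2 is closed,
   the closure in TS2 is the closure in the ambient space. *)
definition regularized_level ::
    "(real^2 \<Rightarrow> real^2 \<Rightarrow> real) \<Rightarrow> real \<Rightarrow> ((real^3) \<times> (real^3)) set" where
  "regularized_level H c = closure ((Phi \<circ> Psi) ` {(q, p). q \<noteq> 0 \<and> H q p = - c})"

definition hypersurface ::
    "(real^2 \<Rightarrow> real^2 \<Rightarrow> real) \<Rightarrow> real \<Rightarrow> ((real^3) \<times> (real^3)) set" where
  "hypersurface H c = (THE C. C \<in> components (regularized_level H c) \<and> bounded C)"

definition bounded_domain :: "((real^3) \<times> (real^3)) set \<Rightarrow> ((real^3) \<times> (real^3)) set" where
  "bounded_domain S = S \<union> \<Union> {C \<in> components (TS2 - S). bounded C}"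

(* Minus the critical value of H_H; the one of H_R is -3/2, and M_R c is meaningful
   for c > 3/2 only. *)
definition c_H0 :: real where
  "c_H0 = 3 powr (4/3) / 2"

definition M_R :: "real \<Rightarrow> ((real^3) \<times> (real^3)) set" where
  "M_R c = bounded_domain (hypersurface H_R c)"

(* The critical level c_H0 gets the limiting domain; M_H c is meaningful for
   c \<ge> c_H0 only. *)
definition M_H :: "real \<Rightarrow> ((real^3) \<times> (real^3)) set" where
  "M_H c = (if c = c_H0 then closure (\<Union>c'\<in>{c_H0<..}. bounded_domain (hypersurface H_H c'))
            else bounded_domain (hypersurface H_H c))"

definition c_R :: "nat \<Rightarrow> real" where
  "c_R P = (real P + 3) / (2 * root 3 (real P + 1))"

definition c_H :: "nat \<Rightarrow> real" where
  "c_H P = (2 * real P + 8 - sqrt ((real P + 1) * (real P + 9))) / (2 * root 3 (real P + 1))"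

end

theory Submission
  imports Defs
begin

text \<open>
  Both Hamiltonians belong to the family \<open>tidal A B = H_R + A q\<^sub>1\<^sup>2 + B q\<^sub>2\<^sup>2\<close>, and the proof has two
  independent parts: an explicit description of the bounded domain for a member of this family, and
  an elementary comparison of \<open>H_R\<close> with \<open>H_H\<close>.

  For the first part, \<open>1 + |q| (H + c)\<close> is written in coordinates of the cotangent bundle of the
  sphere; it becomes a continuous function \<open>reg_energy\<close>, cubic on fibre rays, whose level \<open>1\<close> is the
  regularized level (\<open>regularized_level_eq\<close>).  Let \<open>\<rho>\<close> be the distance of the critical points from the
  origin.  On the circle \<open>|q| = \<rho>\<close> the effective potential exceeds \<open>- c\<close>, so the level avoids
  this circle.  Along a fibre ray with \<open>0 < |q| \<le> \<rho>\<close> the Hamiltonian is concave, it tends to \<open>- \<infinity>\<close>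
  at \<open>q = 0\<close>, and it is greater than \<open>- c\<close> at \<open>|q| = \<rho>\<close>; over the north pole, where \<open>q = 0\<close>, \<open>reg_energy\<close> is
  \<open>|\<eta>|\<close>.  So each fibre ray meets the inner part of the level exactly once.  This inner part is
  therefore homeomorphic to the unit bundle and connected.  The outer part has no
  bounded component, because scaling \<open>q\<close> up increases minus the effective potential, which leaves room
  for a momentum of the right energy (\<open>outer_level_unbounded\<close>).  Hence the
  bounded component is the inner part (\<open>hypersurface_eq\<close>), and the domain it bounds is
  \<open>{|q| \<le> \<rho>, reg_energy \<le> 1}\<close> (\<open>bounded_domain_eq\<close>).

  For the second part, \<open>H_R - H_H = q\<^sub>1\<^sup>2 - q\<^sub>2\<^sup>2 / 2\<close> depends on \<open>q\<close> only, so an inclusion needs only a bound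
  for this difference over the bounded Hill region.  From \<open>H_H \<le> - c\<close> follows
  \<open>1 / |q| + 3/2 |q|\<^sup>2 \<ge> c\<close>, and the left side decreases up to the critical radius; at \<open>c = c_H P\<close> this confines
  \<open>|q|\<close> to a radius \<open>x\<close> with \<open>x\<^sup>2 = c_H P - c_R P\<close> (\<open>c_H_attained_at_radius\<close>), exactly the bound that is
  needed.  In the other direction, \<open>H_R \<le> - (c + 1 / (2 c\<^sup>2))\<close> confines \<open>|q|\<close> to \<open>1 / c\<close>.
\<close>

section \<open>The cotangent lift of inverse stereographic projection\<close>

lemma norm2_sq: "(norm (v::real^2))\<^sup>2 = (v$1)\<^sup>2 + (v$2)\<^sup>2"
  by (simp only: power2_norm_eq_inner inner_vec_def sum_2) (simp add: power2_eq_square)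

lemma norm3_sq: "(norm (v::real^3))\<^sup>2 = (v$1)\<^sup>2 + (v$2)\<^sup>2 + (v$3)\<^sup>2"
  by (simp only: power2_norm_eq_inner inner_vec_def sum_3) (simp add: power2_eq_square)

lemma inner3: "(v::real^3) \<bullet> w = v$1 * w$1 + v$2 * w$2 + v$3 * w$3"
  by (simp add: inner_vec_def sum_3)

lemma inner2: "(v::real^2) \<bullet> w = v$1 * w$1 + v$2 * w$2"
  by (simp add: inner_vec_def sum_2)

lemma vec3_eq_iff: "(v::real^3) = w \<longleftrightarrow> v$1 = w$1 \<and> v$2 = w$2 \<and> v$3 = w$3"
  by (simp add: vec_eq_iff forall_3)

lemma vec2_eq_iff: "(v::real^2) = w \<longleftrightarrow> v$1 = w$1 \<and> v$2 = w$2"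
  by (simp add: vec_eq_iff forall_2)

lemma vec2_axis: "vector [a, b] = a *\<^sub>R axis 1 1 + (b *\<^sub>R axis 2 1 :: real^2)"
  by (simp add: vec2_eq_iff axis_def)

text \<open>The closed form of \<open>Phi \<circ> Psi\<close>.  The differential \<open>D\<close> of \<open>stereo_inv\<close> at \<open>p\<close> is conformal with
factor \<open>2 / (|p|\<^sup>2 + 1)\<close>, so the covector that pulls back to \<open>y\<close> is \<open>((|p|\<^sup>2 + 1) / 2)\<^sup>2 D y\<close>; here
\<open>y = - q\<close>.\<close>

definition to_sphere :: "(real^2) \<times> (real^2) \<Rightarrow> (real^3) \<times> (real^3)" where
  "to_sphere = (\<lambda>(q, p). (stereo_inv p,
     vector [(p \<bullet> q) * p$1 - ((norm p)\<^sup>2 + 1) / 2 * q$1,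
             (p \<bullet> q) * p$2 - ((norm p)\<^sup>2 + 1) / 2 * q$2,
             - (p \<bullet> q)]))"

text \<open>Written as \<open>(2 / (|x|\<^sup>2 + 1)) (x, 0) + (1 - 2 / (|x|\<^sup>2 + 1)) e\<^sub>3\<close>, the inverse projection is a sum of
products of a linear map and functions of \<open>|x|\<^sup>2\<close>.\<close>

lemma stereo_inv_has_derivative:
  "(stereo_inv has_derivative (\<lambda>v. vector
      [2 * v$1 / ((norm x)\<^sup>2 + 1) - 4 * (x \<bullet> v) * x$1 / ((norm x)\<^sup>2 + 1)\<^sup>2,
       2 * v$2 / ((norm x)\<^sup>2 + 1) - 4 * (x \<bullet> v) * x$2 / ((norm x)\<^sup>2 + 1)\<^sup>2,
       4 * (x \<bullet> v) / ((norm x)\<^sup>2 + 1)\<^sup>2])) (at x)"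
proof -
  define E :: "real^2 \<Rightarrow> real^3" where "E v = vector [v$1, v$2, 0]" for v
  have "linear E"
    by (rule linearI) (simp_all add: E_def vec3_eq_iff)
  then have E: "bounded_linear E"
    by (rule linear_conv_bounded_linear[THEN iffD1])
  have eq: "stereo_inv = (\<lambda>x. (2 / (x \<bullet> x + 1)) *\<^sub>R E x + (1 - 2 / (x \<bullet> x + 1)) *\<^sub>R axis 3 1)"
  proof
    fix x :: "real^2"
    have "x \<bullet> x + 1 > 0" by (simp add: add_nonneg_pos)
    then show "stereo_inv x = (2 / (x \<bullet> x + 1)) *\<^sub>R E x + (1 - 2 / (x \<bullet> x + 1)) *\<^sub>R axis 3 1"
      by (simp add: stereo_inv_def E_def vec3_eq_iff axis_def power2_norm_eq_inner field_simps)
  qed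
  have pos: "x \<bullet> x + 1 \<noteq> 0"
    by (metis add_nonneg_pos inner_ge_zero less_irrefl zero_less_one)
  show ?thesis
    unfolding eq
    apply (rule has_derivative_eq_rhs)
    apply (rule derivative_eq_intros bounded_linear.has_derivative[OF E] refl pos)+
    apply (rule ext)
    using pos
    apply (simp add: E_def vec3_eq_iff axis_def power2_norm_eq_inner inner_commute)
    apply (simp add: field_simps power2_eq_square)
    done
qed

lemma stereo_inv_nth [simp]:
  "stereo_inv p $ 1 = 2 * p$1 / ((norm p)\<^sup>2 + 1)"
  "stereo_inv p $ 2 = 2 * p$2 / ((norm p)\<^sup>2 + 1)"
  "stereo_inv p $ 3 = ((norm p)\<^sup>2 - 1) / ((norm p)\<^sup>2 + 1)"
  by (simp_all add: stereo_inv_def)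

text \<open>The explicit covector satisfies the defining conditions of the lift, and it is the only one: the
difference \<open>z\<close> of two candidates annihilates the image of the differential and the normal vector
\<open>stereo_inv p\<close>, three linear equations with the single solution \<open>0\<close>.\<close>

lemma Phi_Psi_eq: "Phi \<circ> Psi = to_sphere"
proof (rule ext, clarify)
  fix q p :: "real^2"
  define n where "n = (norm p)\<^sup>2"
  have n0: "n \<ge> 0" by (simp add: n_def)
  have np: "(p$1)\<^sup>2 + (p$2)\<^sup>2 = n" by (simp add: n_def norm2_sq)
  let ?D = "frechet_derivative stereo_inv (at p)"
  have D: "?D = (\<lambda>v. vector
      [2 * v$1 / (n + 1) - 4 * (p \<bullet> v) * p$1 / (n + 1)\<^sup>2,
       2 * v$2 / (n + 1) - 4 * (p \<bullet> v) * p$2 / (n + 1)\<^sup>2,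
       4 * (p \<bullet> v) / (n + 1)\<^sup>2])"
    unfolding n_def by (rule frechet_derivative_at[OF stereo_inv_has_derivative, symmetric])
  let ?P = "\<lambda>\<eta>. \<eta> \<bullet> stereo_inv p = 0 \<and> (\<forall>v. \<eta> \<bullet> ?D v = (- q) \<bullet> v)"
  let ?e = "snd (to_sphere (q, p))"
  \<comment> \<open>Naming the two fractions makes the identities below polynomial modulo \<open>2 * h * i = 1\<close>.\<close>
  define i h where "i = 1 / (n + 1)" and "h = (n + 1) / 2"
  have hi: "2 * h * i = 1" and nh: "(p$1)\<^sup>2 + (p$2)\<^sup>2 = 2 * h - 1" and n: "n = 2 * h - 1"
    using n0 np by (simp_all add: i_def h_def field_simps)
  have i2: "x / (n + 1) = x * i" "x / (n + 1)\<^sup>2 = x * i\<^sup>2" for x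
    by (simp_all add: i_def power2_eq_square)
  have ex: "?P ?e"
  proof (intro conjI allI)
    show "?e \<bullet> stereo_inv p = 0"
      apply (simp add: to_sphere_def inner3 inner2 i2 flip: n_def h_def)
      using nh hi n by algebra
    fix v :: "real^2"
    show "?e \<bullet> ?D v = (- q) \<bullet> v"
      unfolding D i2
      apply (simp add: to_sphere_def inner3 inner2 flip: n_def h_def)
      using nh hi n by algebra
  qed
  have un: "\<eta> = ?e" if "?P \<eta>" for \<eta>
  proof -
    define z where "z = \<eta> - ?e"
    have z0: "z \<bullet> stereo_inv p = 0" and zv: "z \<bullet> ?D v = 0" for v
      using that ex by (simp_all add: z_def inner_diff_left)
    have e0: "2 * (z$1 * p$1 + z$2 * p$2) + z$3 * (n - 1) = 0"
      using z0 n0 by (simp add: inner3 divide_simps add_nonneg_eq_0_iff flip: n_def)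
    have e1: "(n + 1) * z$1 = 2 * p$1 * (z$1 * p$1 + z$2 * p$2 - z$3)"
    proof -
      have "2 * i * z$1 - 4 * i\<^sup>2 * p$1 * (z$1 * p$1 + z$2 * p$2 - z$3) = 0"
        using zv[of "axis 1 1"] unfolding D i2
        by (simp add: inner3 inner2 axis_def algebra_simps)
      then show ?thesis using hi n by algebra
    qed
    have e2: "(n + 1) * z$2 = 2 * p$2 * (z$1 * p$1 + z$2 * p$2 - z$3)"
    proof -
      have "2 * i * z$2 - 4 * i\<^sup>2 * p$2 * (z$1 * p$1 + z$2 * p$2 - z$3) = 0"
        using zv[of "axis 2 1"] unfolding D i2
        by (simp add: inner3 inner2 axis_def algebra_simps)
      then show ?thesis using hi n by algebra
    qed
    have "(n + 1) * (n + 1) * z$3 = 0"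
      using e0 e1 e2 np by algebra
    then have z3: "z$3 = 0" using n0 by simp
    with e0 have "z$1 * p$1 + z$2 * p$2 - z$3 = 0" by simp
    with e1 e2 have "(n + 1) * z$1 = 0" "(n + 1) * z$2 = 0" by (metis mult_zero_right)+
    with n0 have "z$1 = 0" "z$2 = 0" by auto
    with z3 have "z = 0" by (simp add: vec3_eq_iff)
    then show ?thesis by (simp add: z_def)
  qed
  have "(THE \<eta>. ?P \<eta>) = ?e"
    using ex un by (rule the_equality)
  then show "(Phi \<circ> Psi) (q, p) = to_sphere (q, p)"
    by (simp add: Phi_def Psi_def to_sphere_def)
qed

section \<open>Position and momentum as functions on the cotangent bundle\<close>

lemma TS2_iff: "(x, \<eta>) \<in> TS2 \<longleftrightarrow>
    (x$1)\<^sup>2 + (x$2)\<^sup>2 + (x$3)\<^sup>2 = 1 \<and> \<eta>$1 * x$1 + \<eta>$2 * x$2 + \<eta>$3 * x$3 = 0"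
proof -
  have "norm x = 1 \<longleftrightarrow> (norm x)\<^sup>2 = 1"
    by (smt (verit) norm_ge_zero power2_eq_1_iff)
  then show ?thesis
    by (simp add: TS2_def norm3_sq inner3)
qed

lemma TS2_nth_le_1:
  assumes "z \<in> TS2"
  shows "fst z $ 3 \<le> 1"
proof -
  have "\<bar>fst z $ 3\<bar> \<le> norm (fst z)" by (rule component_le_norm_cart)
  with assms show ?thesis by (auto simp: TS2_def)
qed

text \<open>The position \<open>q\<close> as a polynomial in the base point \<open>x\<close> and the covector \<open>\<eta>\<close>: minus the pullback of \<open>\<eta>\<close>
in the stereographic chart.  Unlike the momentum it extends to the fibre over the north pole, where
it vanishes.\<close>

definition chart_pos :: "(real^3) \<times> (real^3) \<Rightarrow> real^2" where
  "chart_pos z = vector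
     [- (snd z $ 1 * (1 - fst z $ 3) + fst z $ 1 * snd z $ 3),
      - (snd z $ 2 * (1 - fst z $ 3) + fst z $ 2 * snd z $ 3)]"

definition chart_mom :: "(real^3) \<times> (real^3) \<Rightarrow> real^2" where
  "chart_mom z = vector [fst z $ 1 / (1 - fst z $ 3), fst z $ 2 / (1 - fst z $ 3)]"

text \<open>On \<open>TS2\<close> this is \<open>|q|\<close>, because the chart is conformal.  It scales linearly along the fibres.\<close>

definition chart_radius :: "(real^3) \<times> (real^3) \<Rightarrow> real" where
  "chart_radius z = norm (snd z) * (1 - fst z $ 3)"

lemma chart_pos_nth [simp]:
  "chart_pos z $ 1 = - (snd z $ 1 * (1 - fst z $ 3) + fst z $ 1 * snd z $ 3)"
  "chart_pos z $ 2 = - (snd z $ 2 * (1 - fst z $ 3) + fst z $ 2 * snd z $ 3)"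
  by (simp_all add: chart_pos_def)

lemma norm_chart_pos:
  assumes "z \<in> TS2"
  shows "norm (chart_pos z) = chart_radius z"
proof -
  obtain x \<eta> where z: "z = (x, \<eta>)" by fastforce
  have *: "(x$1)\<^sup>2 + (x$2)\<^sup>2 + (x$3)\<^sup>2 = 1" "\<eta>$1 * x$1 + \<eta>$2 * x$2 + \<eta>$3 * x$3 = 0"
    using assms by (simp_all add: z TS2_iff)
  have "(norm (chart_pos z))\<^sup>2 = (chart_radius z)\<^sup>2"
    unfolding chart_radius_def power_mult_distrib norm2_sq norm3_sq chart_pos_nth
    apply (simp add: z)
    using * by algebra
  moreover have "chart_radius z \<ge> 0"
    using TS2_nth_le_1[OF assms] by (simp add: chart_radius_def)
  ultimately show ?thesis by simp
qed

lemma chart_radius_nonneg: "z \<in> TS2 \<Longrightarrow> chart_radius z \<ge> 0"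
  using norm_chart_pos norm_ge_zero by metis

lemma
  shows to_sphere_in_TS2: "to_sphere (q, p) \<in> TS2"
    and to_sphere_nth_3: "fst (to_sphere (q, p)) $ 3 = 1 - 2 / ((norm p)\<^sup>2 + 1)"
    and chart_pos_to_sphere: "chart_pos (to_sphere (q, p)) = q"
    and chart_mom_to_sphere: "chart_mom (to_sphere (q, p)) = p"
    and spin_to_sphere: "fst (to_sphere (q, p)) $ 2 * snd (to_sphere (q, p)) $ 1
         - fst (to_sphere (q, p)) $ 1 * snd (to_sphere (q, p)) $ 2 = p$1 * q$2 - p$2 * q$1"
proof -
  define n where "n = (norm p)\<^sup>2"
  have n0: "n \<ge> 0" by (simp add: n_def)
  have np: "(p$1)\<^sup>2 + (p$2)\<^sup>2 = n" by (simp add: n_def norm2_sq)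
  define i h where "i = 1 / (n + 1)" and "h = (n + 1) / 2"
  have hi: "2 * h * i = 1" and nh: "(p$1)\<^sup>2 + (p$2)\<^sup>2 = 2 * h - 1" and n: "n = 2 * h - 1"
    using n0 np by (simp_all add: i_def h_def field_simps)
  have i2: "x / (n + 1) = x * i" for x
    by (simp_all add: i_def)
  show "to_sphere (q, p) \<in> TS2"
    unfolding to_sphere_def prod.case TS2_iff
    apply (simp add: inner2 i2 flip: n_def h_def)
    using nh hi n by algebra
  show x3: "fst (to_sphere (q, p)) $ 3 = 1 - 2 / ((norm p)\<^sup>2 + 1)"
    apply (simp add: to_sphere_def i2 flip: n_def)
    using hi n by algebra
  then have x3: "1 - fst (to_sphere (q, p)) $ 3 = 2 * i"
    by (simp add: i2 flip: n_def)
  show "chart_pos (to_sphere (q, p)) = q"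
    unfolding vec2_eq_iff chart_pos_nth x3
  proof
    show "- (snd (to_sphere (q, p)) $ 1 * (2 * i) + fst (to_sphere (q, p)) $ 1 * snd (to_sphere (q, p)) $ 3) = q$1"
      apply (simp add: to_sphere_def inner2 i2 flip: n_def h_def)
      using nh hi n by algebra
    show "- (snd (to_sphere (q, p)) $ 2 * (2 * i) + fst (to_sphere (q, p)) $ 2 * snd (to_sphere (q, p)) $ 3) = q$2"
      apply (simp add: to_sphere_def inner2 i2 flip: n_def h_def)
      using nh hi n by algebra
  qed
  show "chart_mom (to_sphere (q, p)) = p"
    unfolding chart_mom_def x3
    using hi by (auto simp add: to_sphere_def vec2_eq_iff i2 simp flip: n_def)
  show "fst (to_sphere (q, p)) $ 2 * snd (to_sphere (q, p)) $ 1
         - fst (to_sphere (q, p)) $ 1 * snd (to_sphere (q, p)) $ 2 = p$1 * q$2 - p$2 * q$1"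
    apply (simp add: to_sphere_def inner2 i2 flip: n_def h_def)
    using nh hi n by algebra
qed

lemma to_sphere_nth_3_neq: "fst (to_sphere (q, p)) $ 3 \<noteq> 1"
  using add_nonneg_pos[of "(norm p)\<^sup>2" 1] by (simp add: to_sphere_nth_3)

text \<open>Away from the fibre over the north pole every point comes from exactly one phase point, so a
statement about \<open>TS2\<close> can be read off in \<open>(q, p)\<close>.\<close>

lemma to_sphere_chart:
  assumes "z \<in> TS2" "fst z $ 3 \<noteq> 1"
  shows "to_sphere (chart_pos z, chart_mom z) = z"
proof -
  obtain x \<eta> where z: "z = (x, \<eta>)" by fastforce
  have *: "(x$1)\<^sup>2 + (x$2)\<^sup>2 + (x$3)\<^sup>2 = 1" "\<eta>$1 * x$1 + \<eta>$2 * x$2 + \<eta>$3 * x$3 = 0"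
    using assms by (simp_all add: z TS2_iff)
  define j where "j = 1 / (1 - x$3)"
  have j: "j * (1 - x$3) = 1" using assms by (simp add: j_def z)
  have m: "chart_mom z $ 1 = x$1 * j" "chart_mom z $ 2 = x$2 * j"
    by (simp_all add: chart_mom_def z j_def)
  have n: "(norm (chart_mom z))\<^sup>2 + 1 = 2 * j"
    unfolding norm2_sq m using j * by algebra
  then have n': "(norm (chart_mom z))\<^sup>2 = 2 * j - 1" by simp
  have j0: "j \<noteq> 0" using j by auto
  have 1: "stereo_inv (chart_mom z) = x"
    unfolding vec3_eq_iff stereo_inv_nth n n' m using j0 j by (simp add: field_simps)
  let ?s = "chart_mom z \<bullet> chart_pos z"
  have d: "(x$1)\<^sup>2 + (x$2)\<^sup>2 = 1 - (x$3)\<^sup>2" using * by simp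
  have s: "?s = - \<eta>$3"
  proof -
    have "?s = - j * ((1 - x$3) * (\<eta>$1 * x$1 + \<eta>$2 * x$2) + \<eta>$3 * ((x$1)\<^sup>2 + (x$2)\<^sup>2))"
      unfolding inner2 m by (simp add: z power2_eq_square algebra_simps)
    also have "\<eta>$1 * x$1 + \<eta>$2 * x$2 = - (\<eta>$3 * x$3)" using * by simp
    also have "- j * ((1 - x$3) * - (\<eta>$3 * x$3) + \<eta>$3 * ((x$1)\<^sup>2 + (x$2)\<^sup>2))
        = - (j * (1 - x$3)) * \<eta>$3"
      unfolding d by (simp add: power2_eq_square algebra_simps)
    finally show ?thesis by (simp add: j)
  qed
  have comp: "- \<eta>$3 * (a * j) - j * (- (e * (1 - x$3) + a * \<eta>$3)) = e" for a e
  proof -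
    have "- \<eta>$3 * (a * j) - j * (- (e * (1 - x$3) + a * \<eta>$3)) = e * (j * (1 - x$3))"
      by (simp add: algebra_simps)
    then show ?thesis by (simp add: j)
  qed
  show ?thesis
    using comp unfolding to_sphere_def prod.case 1 n s by (simp add: z vec3_eq_iff m[unfolded z])
qed

section \<open>A family of Hamiltonians containing both problems\<close>

definition tidal :: "real \<Rightarrow> real \<Rightarrow> real^2 \<Rightarrow> real^2 \<Rightarrow> real" where
  "tidal A B q p = H_R q p + A * (q$1)\<^sup>2 + B * (q$2)\<^sup>2"

lemma H_R_eq_tidal: "H_R = tidal 0 0"
  by (intro ext) (simp add: tidal_def)

lemma H_H_eq_tidal: "H_H = tidal (-1) (1/2)"
  by (intro ext) (simp add: tidal_def H_H_def)

text \<open>Minus the effective potential; the effective potential is what is left of the Hamiltonian when the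
kinetic term of the rotating frame, which vanishes at \<open>p = (- q\<^sub>2, q\<^sub>1)\<close>, is taken away.  The level \<open>- c\<close> projects to the Hill
region \<open>eff A B q \<ge> c\<close>.\<close>

definition eff :: "real \<Rightarrow> real \<Rightarrow> real^2 \<Rightarrow> real" where
  "eff A B q = 1 / norm q + (1/2 - A) * (q$1)\<^sup>2 + (1/2 - B) * (q$2)\<^sup>2"

lemma tidal_eq: "tidal A B q p = ((p$1 + q$2)\<^sup>2 + (p$2 - q$1)\<^sup>2) / 2 - eff A B q"
  unfolding tidal_def H_R_def eff_def norm2_sq
  by (simp add: power2_eq_square algebra_simps add_divide_distrib diff_divide_distrib)

lemma tidal_ge: "- eff A B q \<le> tidal A B q p"
  by (simp add: tidal_eq)

text \<open>The regularized Hamiltonian \<open>1 + |q| (H + c)\<close>, whose level \<open>1\<close> is the energy level \<open>- c\<close>.  In the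
coordinates \<open>(x, \<eta>)\<close> the collision singularity at \<open>q = 0\<close> has disappeared: the formula is continuous on
all of \<open>TS2\<close>, is \<open>0\<close> on the zero section and is \<open>|\<eta>|\<close> on the fibre over the north pole.\<close>

definition reg_energy :: "real \<Rightarrow> real \<Rightarrow> real \<Rightarrow> (real^3) \<times> (real^3) \<Rightarrow> real" where
  "reg_energy A B c z = norm (snd z) + chart_radius z * (c - 1/2 + (fst z $ 2 * snd z $ 1 - fst z $ 1 * snd z $ 2)
      + A * (chart_pos z $ 1)\<^sup>2 + B * (chart_pos z $ 2)\<^sup>2)"

lemma norm_snd_to_sphere: "norm (snd (to_sphere (q, p))) = norm q * ((norm p)\<^sup>2 + 1) / 2"
proof -
  have "norm q = chart_radius (to_sphere (q, p))"
    using norm_chart_pos[OF to_sphere_in_TS2[of q p]] by (simp add: chart_pos_to_sphere)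
  moreover have "(norm p)\<^sup>2 + 1 > 0" by (simp add: add_nonneg_pos)
  ultimately show ?thesis
    by (simp add: chart_radius_def to_sphere_nth_3)
qed

lemma chart_radius_to_sphere: "chart_radius (to_sphere (q, p)) = norm q"
  using norm_chart_pos[OF to_sphere_in_TS2[of q p]] by (simp add: chart_pos_to_sphere)

lemma reg_energy_to_sphere:
  assumes "q \<noteq> 0"
  shows "reg_energy A B c (to_sphere (q, p)) = 1 + norm q * (tidal A B q p + c)"
proof -
  obtain k where k: "k = 1 / norm q" by blast
  then have "norm q * k = 1" using assms by simp
  then show ?thesis
    unfolding reg_energy_def spin_to_sphere chart_pos_to_sphere norm_snd_to_sphere chart_radius_to_sphere
      tidal_def H_R_def k[symmetric]
    by (simp add: algebra_simps add_divide_distrib)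
qed

section \<open>Continuity and scaling along the fibres\<close>

lemma vec3_axis: "vector [a, b, c] = a *\<^sub>R axis 1 1 + b *\<^sub>R axis 2 1 + (c *\<^sub>R axis 3 1 :: real^3)"
  by (simp add: vec3_eq_iff axis_def)

lemma continuous_on_to_sphere: "continuous_on UNIV to_sphere"
proof -
  have "(norm (p::real^2))\<^sup>2 + 1 \<noteq> 0" for p
    using add_nonneg_pos[of "(norm p)\<^sup>2" 1] by simp
  then show ?thesis
    unfolding to_sphere_def case_prod_unfold stereo_inv_def vec3_axis
    by (intro continuous_intros ballI) auto
qed

lemma continuous_on_chart_radius: "continuous_on UNIV chart_radius"
  unfolding chart_radius_def by (intro continuous_intros)

lemma continuous_on_reg_energy: "continuous_on UNIV (reg_energy A B c)"
  unfolding reg_energy_def chart_radius_def chart_pos_nth by (intro continuous_intros)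

lemma chart_radius_scale: "0 \<le> t \<Longrightarrow> chart_radius (x, t *\<^sub>R \<eta>) = t * chart_radius (x, \<eta>)"
  by (simp add: chart_radius_def)

lemma TS2_scale: "(x, \<eta>) \<in> TS2 \<Longrightarrow> (x, t *\<^sub>R \<eta>) \<in> TS2"
  by (simp add: TS2_def)

lemma reg_energy_scale:
  assumes "0 \<le> t"
  shows "reg_energy A B c (x, t *\<^sub>R \<eta>) = t * (norm \<eta> + chart_radius (x, \<eta>) * (c - 1/2)
    + chart_radius (x, \<eta>) * (x$2 * \<eta>$1 - x$1 * \<eta>$2) * t
    + chart_radius (x, \<eta>) * (A * (chart_pos (x, \<eta>) $ 1)\<^sup>2 + B * (chart_pos (x, \<eta>) $ 2)\<^sup>2) * t\<^sup>2)"
  using assms unfolding reg_energy_def chart_radius_scale[OF assms] chart_pos_nth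
  by (simp add: power2_eq_square algebra_simps)

text \<open>The function \<open>g t = a + b * t + d * t\<^sup>2 - 1 / t\<close> has second derivative \<open>2 * d - 2 / t ^ 3\<close>, so it is
strictly concave on \<open>{0<..w}\<close> when \<open>d * w ^ 3 < 1\<close>, and a strictly concave function that is nonnegative at \<open>u\<close> and \<open>w\<close> is
positive between.  The proof uses the exact interpolation formula: the divided difference of
\<open>g\<close> at \<open>u, v, w\<close> is \<open>d - 1 / (u * v * w)\<close>.\<close>

lemma cubic_gt_1_between:
  fixes a b d u v w :: real
  assumes "0 < u" "u < v" "v < w" "d * w ^ 3 < 1"
    and "u * (a + b * u + d * u\<^sup>2) \<ge> 1" "w * (a + b * w + d * w\<^sup>2) \<ge> 1"
  shows "v * (a + b * v + d * v\<^sup>2) > 1"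
proof -
  define G where "G t = t * (a + b * t + d * t\<^sup>2) - 1" for t
  have "d * (u * v * w) < 1"
  proof (cases "d \<le> 0")
    case True
    then have "d * (u * v * w) \<le> 0"
      using assms by (intro mult_nonpos_nonneg) auto
    then show ?thesis by simp
  next
    case False
    have "u * v * w \<le> w * w * w"
      using assms by (intro mult_mono) auto
    then have "d * (u * v * w) \<le> d * (w * w * w)"
      using False by (intro mult_left_mono) auto
    then show ?thesis using assms by (simp add: power3_eq_cube)
  qed
  then have "0 < (v - u) * (w - v) * (w - u) * (1 - d * (u * v * w))"
    using assms by (intro mult_pos_pos) auto
  also have "\<dots> \<le> v * w * (w - v) * G u + u * v * (v - u) * G w + \<dots>"
    using assms by (simp add: G_def)
  also have "\<dots> = u * w * (w - u) * G v"
    unfolding G_def by algebra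
  finally have "0 < u * w * (w - u) * G v" .
  moreover have "0 < u * w * (w - u)" using assms by (intro mult_pos_pos) auto
  ultimately have "G v > 0" by (simp only: zero_less_mult_pos)
  then show ?thesis by (simp add: G_def)
qed

section \<open>The unit cotangent bundle of the sphere\<close>

text \<open>The circle is the radial image of a punctured plane.\<close>

lemma connected_unit_circle:
  fixes x :: "real^3"
  assumes "norm x = 1"
  shows "connected {u. norm u = 1 \<and> u \<bullet> x = 0}"
proof -
  let ?V = "{u. x \<bullet> u = 0}"
  have "x \<noteq> 0" using assms by auto
  then have "aff_dim ?V = 2"
    by (simp add: aff_dim_subspace subspace_hyperplane dim_hyperplane)
  then have "connected (?V - {0})"
    by (intro connected_punctured_convex) (auto simp: subspace_hyperplane subspace_imp_convex)
  then have "connected ((\<lambda>u. u /\<^sub>R norm u) ` (?V - {0}))"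
    by (rule connected_continuous_image[rotated]) (auto intro!: continuous_intros)
  also have "(\<lambda>u. u /\<^sub>R norm u) ` (?V - {0}) = {u. norm u = 1 \<and> u \<bullet> x = 0}" (is "?L = ?R")
  proof
    show "?L \<subseteq> ?R" by (auto simp: inner_commute)
    show "?R \<subseteq> ?L"
    proof
      fix u assume "u \<in> ?R"
      then show "u \<in> ?L"
        by (intro image_eqI[of _ _ u]) (auto simp: inner_commute)
    qed
  qed
  finally show ?thesis .
qed

definition unit_bundle :: "((real^3) \<times> (real^3)) set" where
  "unit_bundle = {z \<in> TS2. norm (snd z) = 1}"

lemma unit_bundle_iff: "(x, u) \<in> unit_bundle \<longleftrightarrow> norm x = 1 \<and> norm u = 1 \<and> u \<bullet> x = 0"
  by (auto simp: unit_bundle_def TS2_def)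

text \<open>A point \<open>(x, u)\<close> is joined to \<open>(x', u')\<close> through a unit vector \<open>w\<close> orthogonal to both \<open>x\<close> and \<open>x'\<close>: turn
\<open>u\<close> to \<open>w\<close> with \<open>x\<close> at rest, turn \<open>x\<close> to \<open>x'\<close> with \<open>w\<close> at rest, and turn \<open>w\<close> to \<open>u'\<close>.  Each move stays on a unit
circle.\<close>

lemma connected_unit_bundle: "connected unit_bundle"
  unfolding connected_iff_connected_component
proof (intro ballI)
  have fib: "connected_component unit_bundle (x, u) (x, v)" if "(x, u) \<in> unit_bundle" "(x, v) \<in> unit_bundle" for x u v
    unfolding connected_component_def
  proof (intro exI conjI)
    show "connected (Pair x ` {u. norm u = 1 \<and> u \<bullet> x = 0})"
      using that by (intro connected_continuous_image connected_unit_circle continuous_intros)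
        (simp add: unit_bundle_iff)
  qed (use that in \<open>auto simp: unit_bundle_iff\<close>)
  have base: "connected_component unit_bundle (x, u) (y, u)" if "(x, u) \<in> unit_bundle" "(y, u) \<in> unit_bundle" for x y u
    unfolding connected_component_def
  proof (intro exI conjI)
    show "connected ((\<lambda>x. (x, u)) ` {x. norm x = 1 \<and> x \<bullet> u = 0})"
      using that by (intro connected_continuous_image connected_unit_circle continuous_intros)
        (simp add: unit_bundle_iff)
  qed (use that in \<open>auto simp: unit_bundle_iff inner_commute\<close>)
  fix z z' assume "z \<in> unit_bundle" "z' \<in> unit_bundle"
  moreover obtain x u x' u' where z: "z = (x, u)" "z' = (x', u')" by fastforce
  ultimately have zUT: "(x, u) \<in> unit_bundle" "(x', u') \<in> unit_bundle" by auto
  have "card {x, x'} \<le> 2" by (simp add: card_insert_if)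
  then have "dim {x, x'} < DIM(real^3)"
    using dim_le_card'[of "{x, x'}"] by simp
  then obtain w0 where w0: "w0 \<noteq> 0" "\<And>y. y \<in> span {x, x'} \<Longrightarrow> orthogonal w0 y"
    using orthogonal_to_subspace_exists by metis
  define w where "w = w0 /\<^sub>R norm w0"
  have "w0 \<bullet> x = 0" "w0 \<bullet> x' = 0"
    using w0(2) span_base[of x "{x, x'}"] span_base[of x' "{x, x'}"] by (auto simp: orthogonal_def)
  then have w: "(x, w) \<in> unit_bundle" "(x', w) \<in> unit_bundle"
    using zUT w0(1) by (auto simp: unit_bundle_iff w_def)
  show "connected_component unit_bundle z z'"
    unfolding z
    by (rule connected_component_trans[OF fib[OF zUT(1) w(1)]
          connected_component_trans[OF base[OF w] fib[OF w(2) zUT(2)]]])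
qed

text \<open>The fibre over the north pole is nowhere dense: rotating \<open>x\<close> and \<open>u\<close> in their common plane by a small
angle leaves it.\<close>

lemma unit_bundle_subset_closure: "unit_bundle \<subseteq> closure {z \<in> unit_bundle. fst z $ 3 \<noteq> 1}"
proof
  fix z assume "z \<in> unit_bundle"
  moreover obtain x u where z: "z = (x, u)" by fastforce
  ultimately have xu: "norm x = 1" "norm u = 1" "u \<bullet> x = 0" by (auto simp: unit_bundle_iff)
  have xx: "x \<bullet> x = 1" "u \<bullet> u = 1" "x \<bullet> u = 0"
    using xu by (simp_all add: norm_eq_1 inner_commute)
  show "z \<in> closure {z \<in> unit_bundle. fst z $ 3 \<noteq> 1}"
  proof (cases "x$3 = 1")
    case False
    then show ?thesis
      using \<open>z \<in> unit_bundle\<close> by (intro subsetD[OF closure_subset]) (simp add: z)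
  next
    case True
    have "(x$1)\<^sup>2 + (x$2)\<^sup>2 = 0"
      using norm3_sq[of x] xu True by simp
    then have "x$1 = 0" "x$2 = 0" by (simp_all add: sum_power2_eq_zero_iff)
    \<comment> \<open>so the rotated base point has third coordinate \<open>cos s\<close>\<close>
    then have u3: "u$3 = 0" using xu True by (simp add: inner3)
    define s where "s n = inverse (real (Suc n))" for n
    define y where "y n = (cos (s n) *\<^sub>R x - sin (s n) *\<^sub>R u, cos (s n) *\<^sub>R u + sin (s n) *\<^sub>R x)" for n
    have s0: "s \<longlonglongrightarrow> 0"
      unfolding s_def by (rule LIMSEQ_inverse_real_of_nat)
    have "y \<longlonglongrightarrow> (cos 0 *\<^sub>R x - sin 0 *\<^sub>R u, cos 0 *\<^sub>R u + sin 0 *\<^sub>R x)"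
      unfolding y_def by (intro tendsto_intros s0)
    then have lim: "y \<longlonglongrightarrow> z" by (simp add: z)
    have "y n \<in> {z \<in> unit_bundle. fst z $ 3 \<noteq> 1}" for n
    proof -
      have "0 < s n" "s n \<le> 1" by (simp_all add: s_def inverse_le_1_iff)
      then have "cos (s n) < cos 0"
        using pi_gt3 by (intro cos_monotone_0_pi) auto
      then have c: "cos (s n) \<noteq> 1" by simp
      have sc: "(sin (s n))\<^sup>2 + (cos (s n))\<^sup>2 = 1" by simp
      have "y n \<in> unit_bundle"
        unfolding y_def unit_bundle_iff norm_eq_1
        using xx sc by (simp add: inner_add_left inner_add_right inner_diff_left inner_diff_right
            inner_commute power2_eq_square algebra_simps)
      then show ?thesis
        using c by (simp add: y_def u3 True)
    qed
    with lim show ?thesis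
      unfolding closure_sequential by blast
  qed
qed

section \<open>The bounded domain around the origin\<close>

text \<open>The radius \<open>\<rho>\<close> separates the bounded part of the Hill region from the unbounded one.  The two
inequalities \<open>crit\<close> bound \<open>eff A B\<close> on the circle \<open>|q| = \<rho>\<close> by \<open>3 / (2 * \<rho>)\<close>, and by \<open>above\<close> this is less
than \<open>c\<close>: the circle lies outside the Hill region.  The bounds \<open>AB\<close> together with \<open>\<rho> \<le> 1\<close> make the
Hamiltonian concave along rays as long as \<open>|q| \<le> \<rho>\<close>.  For the rotating Kepler problem \<open>\<rho> = 1\<close> and
for Hill's problem \<open>\<rho> ^ 3 = 1 / 3\<close> is the distance of the critical points from the origin.\<close>

locale tidal_well =
  fixes A B \<rho> c :: real
  assumes \<rho>: "0 < \<rho>" "\<rho> \<le> 1"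
    and AB: "A \<le> 1/2" "B \<le> 1/2"
    and crit: "(1 - 2 * A) * \<rho> ^ 3 \<le> 1" "(1 - 2 * B) * \<rho> ^ 3 \<le> 1"
    and above: "3 / 2 < c * \<rho>"
begin

definition well :: "((real^3) \<times> (real^3)) set" where
  "well = {z \<in> TS2. chart_radius z \<le> \<rho> \<and> reg_energy A B c z \<le> 1}"

definition shell :: "((real^3) \<times> (real^3)) set" where
  "shell = {z \<in> TS2. chart_radius z \<le> \<rho> \<and> reg_energy A B c z = 1}"

lemma c_gt: "3 / 2 < c"
proof -
  have "c > 0" using above \<rho> zero_less_mult_pos2[of c \<rho>] by simp
  then have "c * \<rho> \<le> c * 1" using \<rho> by (intro mult_left_mono) auto
  then show ?thesis using above by simp
qed

lemma eff_lt:
  assumes "norm q = \<rho>"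
  shows "eff A B q < c"
proof -
  have 1: "(1/2 - A) * \<rho>\<^sup>2 \<le> 1 / (2 * \<rho>)" "(1/2 - B) * \<rho>\<^sup>2 \<le> 1 / (2 * \<rho>)"
    using \<rho> crit by (simp_all add: field_simps power2_eq_square power3_eq_cube)
  have s: "(q$1)\<^sup>2 + (q$2)\<^sup>2 = \<rho>\<^sup>2" using norm2_sq[of q] assms by simp
  let ?m = "1 / (2 * \<rho>) / \<rho>\<^sup>2"
  have m: "1/2 - A \<le> ?m" "1/2 - B \<le> ?m"
    using 1 \<rho> by (simp_all add: pos_le_divide_eq mult_ac)
  have "(1/2 - A) * (q$1)\<^sup>2 + (1/2 - B) * (q$2)\<^sup>2 \<le> ?m * (q$1)\<^sup>2 + ?m * (q$2)\<^sup>2"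
    using m by (intro add_mono mult_right_mono) auto
  also have "\<dots> = ?m * \<rho>\<^sup>2" using s by (metis distrib_left)
  also have "\<dots> = 1 / (2 * \<rho>)" using \<rho> by simp
  finally have "eff A B q \<le> 1 / \<rho> + 1 / (2 * \<rho>)"
    using assms by (simp add: eff_def)
  also have "\<dots> < c" using above \<rho> by (simp add: field_simps)
  finally show ?thesis .
qed

lemma reg_energy_gt_1_on_barrier:
  assumes "z \<in> TS2" "chart_radius z = \<rho>"
  shows "reg_energy A B c z > 1"
proof -
  have "fst z $ 3 \<noteq> 1" using assms \<rho> by (auto simp: chart_radius_def)
  then have z: "to_sphere (chart_pos z, chart_mom z) = z"
    using assms by (intro to_sphere_chart) auto
  have n: "norm (chart_pos z) = \<rho>" using norm_chart_pos assms by simp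
  then have q0: "chart_pos z \<noteq> 0" using \<rho> by auto
  have "tidal A B (chart_pos z) (chart_mom z) + c > 0"
    using tidal_ge[of A B "chart_pos z" "chart_mom z"] eff_lt[OF n] by linarith
  then have "norm (chart_pos z) * (tidal A B (chart_pos z) (chart_mom z) + c) > 0"
    using q0 by simp
  then show ?thesis
    using reg_energy_to_sphere[OF q0, of A B c "chart_mom z"] z by simp
qed

lemma chart_radius_lt: "z \<in> shell \<Longrightarrow> chart_radius z < \<rho>"
  using reg_energy_gt_1_on_barrier by (fastforce simp: shell_def)

text \<open>Once a ray has left the sublevel it does not come back before \<open>|q| = \<rho>\<close>, by concavity of the
Hamiltonian on the ray and its sign on the barrier.  On the fibre over the north pole the function is
linear on rays.\<close>

lemma reg_energy_gt_1_outward: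
  assumes z: "(x, \<eta>) \<in> TS2" and uv: "0 < u" "u < v" "v * chart_radius (x, \<eta>) \<le> \<rho>"
    and K: "reg_energy A B c (x, u *\<^sub>R \<eta>) \<ge> 1"
  shows "reg_energy A B c (x, v *\<^sub>R \<eta>) > 1"
proof (cases "chart_radius (x, \<eta>) = 0")
  case True
  then have "reg_energy A B c (x, t *\<^sub>R \<eta>) = t * norm \<eta>" if "0 \<le> t" for t
    using reg_energy_scale[OF that] by simp
  then have K': "reg_energy A B c (x, u *\<^sub>R \<eta>) = u * norm \<eta>" "reg_energy A B c (x, v *\<^sub>R \<eta>) = v * norm \<eta>"
    using uv by auto
  then have "norm \<eta> \<noteq> 0" using K by auto
  then have "u * norm \<eta> < v * norm \<eta>" using uv by simp
  then show ?thesis using K K' by simp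
next
  case False
  define r where "r = chart_radius (x, \<eta>)"
  have r: "r > 0" using False chart_radius_nonneg[OF z] by (simp add: r_def)
  let ?Q = "chart_pos (x, \<eta>)"
  define a b d where "a = norm \<eta> + r * (c - 1/2)" and "b = r * (x$2 * \<eta>$1 - x$1 * \<eta>$2)"
    and "d = r * (A * (?Q$1)\<^sup>2 + B * (?Q$2)\<^sup>2)"
  have Kt: "reg_energy A B c (x, t *\<^sub>R \<eta>) = t * (a + b * t + d * t\<^sup>2)" if "0 \<le> t" for t
    unfolding reg_energy_scale[OF that] a_def b_def d_def r_def ..
  define w where "w = \<rho> / r"
  have w: "w > 0" "w * r = \<rho>" using r \<rho> by (simp_all add: w_def)
  have "chart_radius (x, w *\<^sub>R \<eta>) = \<rho>" using w chart_radius_scale[of w x \<eta>] by (simp add: r_def)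
  then have Kw: "reg_energy A B c (x, w *\<^sub>R \<eta>) > 1"
    using reg_energy_gt_1_on_barrier TS2_scale[OF z] by simp
  have "v \<le> w" using uv r by (simp add: w_def r_def field_simps)
  then consider "v = w" | "v < w" by linarith
  then show ?thesis
  proof cases
    case 2
    \<comment> \<open>the cubic coefficient \<open>d\<close> is at most \<open>r ^ 3 / 2\<close>, which gives the concavity hypothesis up to \<open>w\<close>\<close>
    have "A * (?Q$1)\<^sup>2 + B * (?Q$2)\<^sup>2 \<le> 1/2 * (?Q$1)\<^sup>2 + 1/2 * (?Q$2)\<^sup>2"
      using AB by (intro add_mono mult_right_mono) auto
    also have "\<dots> = r\<^sup>2 / 2"
      using norm_chart_pos[OF z] norm2_sq[of ?Q] by (simp add: r_def)
    finally have "d \<le> r * (r\<^sup>2 / 2)"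
      unfolding d_def using r by (intro mult_left_mono) auto
    then have "d * w ^ 3 \<le> r * (r\<^sup>2 / 2) * w ^ 3"
      using w by (intro mult_right_mono) auto
    also have "\<dots> = (w * r) ^ 3 / 2" by (simp add: power2_eq_square power3_eq_cube)
    also have "\<dots> < 1" using w \<rho> power_le_one[of \<rho> 3] by simp
    finally have "d * w ^ 3 < 1" .
    then show ?thesis
      using cubic_gt_1_between[of u v w d a b] K Kw uv w 2 by (simp add: Kt)
  qed (use Kw in simp)
qed

lemma ex_shell_on_ray:
  assumes "(x, \<eta>) \<in> TS2" "\<eta> \<noteq> 0"
  shows "\<exists>t>0. (x, t *\<^sub>R \<eta>) \<in> shell"
proof (cases "chart_radius (x, \<eta>) = 0")
  case True
  define t where "t = 1 / norm \<eta>"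
  have t: "t > 0" "t * norm \<eta> = 1" using assms by (simp_all add: t_def)
  then have "(x, t *\<^sub>R \<eta>) \<in> shell"
    using True \<rho> TS2_scale[OF assms(1)] reg_energy_scale[of t A B c x \<eta>] chart_radius_scale[of t x \<eta>] by (simp add: shell_def)
  with t show ?thesis by blast
next
  case False
  then have r: "chart_radius (x, \<eta>) > 0" using chart_radius_nonneg[OF assms(1)] by simp
  define w where "w = \<rho> / chart_radius (x, \<eta>)"
  have w: "w > 0" "w * chart_radius (x, \<eta>) = \<rho>" using r \<rho> by (simp_all add: w_def)
  let ?k = "\<lambda>t. reg_energy A B c (x, t *\<^sub>R \<eta>)"
  have "?k w > 1"
    using w by (intro reg_energy_gt_1_on_barrier TS2_scale assms) (simp add: chart_radius_scale)
  moreover have k0: "?k 0 = 0" using reg_energy_scale[of 0 A B c x \<eta>] by simp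
  moreover have "continuous_on {0..w} ?k"
    by (intro continuous_on_compose2[OF continuous_on_reg_energy] continuous_intros) auto
  ultimately obtain t where t: "0 \<le> t" "t \<le> w" "?k t = 1"
    using IVT'[of ?k 0 1 w] w by auto
  have "t \<noteq> 0" using t k0 by (metis zero_neq_one)
  moreover have "chart_radius (x, t *\<^sub>R \<eta>) \<le> \<rho>"
    using t w r by (simp add: chart_radius_scale flip: w(2))
  ultimately show ?thesis
    using t TS2_scale[OF assms(1)] by (intro exI[of _ t]) (simp add: shell_def)
qed

lemma shell_unique_on_ray:
  assumes "(x, u *\<^sub>R \<eta>) \<in> shell" "(x, v *\<^sub>R \<eta>) \<in> shell" "(x, \<eta>) \<in> TS2" "0 < u" "0 < v"
  shows "u = v"
proof -
  have *: False if "(x, u *\<^sub>R \<eta>) \<in> shell" "(x, v *\<^sub>R \<eta>) \<in> shell" "0 < u" "u < v" for u v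
    using reg_energy_gt_1_outward[OF assms(3), of u v] that by (simp add: shell_def chart_radius_scale)
  show ?thesis
    using *[of u v] *[of v u] assms by (cases u v rule: linorder_cases) auto
qed

text \<open>The term of \<open>reg_energy\<close> that could compensate a large \<open>|\<eta>|\<close> is \<open>r * L\<close> with \<open>r = |q|\<close> and the angular
momentum \<open>L\<close>.  The Cauchy--Schwarz inequality gives \<open>L\<^sup>2 \<le> 2 * |\<eta>| * r\<close>, hence \<open>|L| \<le> |\<eta>| / 2 + r\<close>: since \<open>r \<le> 1\<close>,
only half of \<open>|\<eta>|\<close> and a constant can be lost.\<close>

lemma norm_fibre_le:
  assumes "z \<in> well"
  shows "norm (snd z) \<le> 4 + 2 * \<bar>A\<bar> + 2 * \<bar>B\<bar>"
proof -
  obtain x \<eta> where z: "z = (x, \<eta>)" by fastforce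
  define r e where "r = chart_radius z" and "e = norm \<eta>"
  have T: "z \<in> TS2" and r: "0 \<le> r" "r \<le> 1" and K1: "reg_energy A B c z \<le> 1"
    using assms \<rho> chart_radius_nonneg by (auto simp: well_def r_def)
  have e: "0 \<le> e" by (simp add: e_def)
  let ?L = "x$2 * \<eta>$1 - x$1 * \<eta>$2" and ?Q = "chart_pos z"
  have x3: "x$3 \<le> 1" using TS2_nth_le_1[OF T] by (simp add: z)
  have xx: "(x$1)\<^sup>2 + (x$2)\<^sup>2 = 1 - (x$3)\<^sup>2" using T by (simp add: z TS2_iff)
  have "?L\<^sup>2 + (x$1 * \<eta>$1 + x$2 * \<eta>$2)\<^sup>2 = ((x$1)\<^sup>2 + (x$2)\<^sup>2) * ((\<eta>$1)\<^sup>2 + (\<eta>$2)\<^sup>2)"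
    by (simp add: power2_eq_square algebra_simps)
  then have "?L\<^sup>2 \<le> ((x$1)\<^sup>2 + (x$2)\<^sup>2) * ((\<eta>$1)\<^sup>2 + (\<eta>$2)\<^sup>2)"
    using zero_le_power2[of "x$1 * \<eta>$1 + x$2 * \<eta>$2"] by linarith
  also have "\<dots> \<le> ((x$1)\<^sup>2 + (x$2)\<^sup>2) * e\<^sup>2"
    by (intro mult_left_mono) (simp_all add: e_def norm3_sq)
  also have "\<dots> \<le> (2 * (1 - x$3)) * e\<^sup>2"
  proof (intro mult_right_mono)
    have "0 \<le> (1 - x$3)\<^sup>2" by simp
    then show "(x$1)\<^sup>2 + (x$2)\<^sup>2 \<le> 2 * (1 - x$3)"
      unfolding xx by (simp add: power2_eq_square algebra_simps)
  qed simp
  also have "\<dots> = 2 * e * r" by (simp add: r_def chart_radius_def z e_def power2_eq_square)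
  also have "\<dots> \<le> (e / 2 + r)\<^sup>2"
    using zero_le_power2[of "e / 2 - r"] by (simp add: power2_eq_square algebra_simps)
  finally have "\<bar>?L\<bar> \<le> e / 2 + r"
    using e r by (metis abs_le_square_iff abs_of_nonneg add_nonneg_nonneg divide_nonneg_pos zero_less_numeral)
  then have "r * ?L \<ge> - (e / 2 + 1)"
  proof -
    have "r * \<bar>?L\<bar> \<le> 1 * (e / 2 + 1)"
      using r \<open>\<bar>?L\<bar> \<le> e / 2 + r\<close> by (intro mult_mono) auto
    moreover have "- (r * \<bar>?L\<bar>) \<le> r * ?L"
      using r by (metis abs_ge_minus_self abs_mult abs_of_nonneg minus_le_iff)
    moreover have "- (e / 2 + 1) \<le> - (r * \<bar>?L\<bar>)" using calculation(1) by simp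
    ultimately show ?thesis by (meson order_trans)
  qed
  moreover have "r * (A * (?Q$1)\<^sup>2 + B * (?Q$2)\<^sup>2) \<ge> - (\<bar>A\<bar> + \<bar>B\<bar>)"
  proof -
    have s: "(?Q$1)\<^sup>2 + (?Q$2)\<^sup>2 = r\<^sup>2"
      using norm2_sq[of ?Q] norm_chart_pos[OF T] by (simp add: r_def)
    have "r\<^sup>2 \<le> 1" using r by (simp add: power_le_one)
    then have q: "(?Q$1)\<^sup>2 \<le> 1" "(?Q$2)\<^sup>2 \<le> 1"
      using s zero_le_power2[of "?Q$1"] zero_le_power2[of "?Q$2"] by linarith+
    have "\<bar>A * (?Q$1)\<^sup>2\<bar> \<le> \<bar>A\<bar> * 1" "\<bar>B * (?Q$2)\<^sup>2\<bar> \<le> \<bar>B\<bar> * 1"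
      unfolding abs_mult using q by (intro mult_left_mono; simp)+
    then have "\<bar>A * (?Q$1)\<^sup>2 + B * (?Q$2)\<^sup>2\<bar> \<le> \<bar>A\<bar> + \<bar>B\<bar>" by linarith
    then have "\<bar>r * (A * (?Q$1)\<^sup>2 + B * (?Q$2)\<^sup>2)\<bar> \<le> 1 * (\<bar>A\<bar> + \<bar>B\<bar>)"
      unfolding abs_mult using r by (intro mult_mono) auto
    then show ?thesis by (metis abs_le_D2 minus_le_iff mult_1)
  qed
  moreover have "r * (c - 1/2) \<ge> 0" using r c_gt by simp
  moreover have "reg_energy A B c z = e + r * (c - 1/2) + r * ?L + r * (A * (?Q$1)\<^sup>2 + B * (?Q$2)\<^sup>2)"
    unfolding reg_energy_def r_def e_def by (simp add: z algebra_simps)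
  ultimately have "e \<le> 4 + 2 * \<bar>A\<bar> + 2 * \<bar>B\<bar>" using K1 by linarith
  then show ?thesis by (simp add: e_def z)
qed

lemma bounded_well: "bounded well"
proof -
  have "well \<subseteq> cball 0 1 \<times> cball 0 (4 + 2 * \<bar>A\<bar> + 2 * \<bar>B\<bar>)"
    using norm_fibre_le by (force simp: well_def TS2_def)
  then show ?thesis
    by (rule bounded_subset[rotated]) (intro bounded_Times bounded_cball)
qed

lemma closed_well: "closed well"
proof -
  have "well = TS2 \<inter> {z. chart_radius z \<le> \<rho>} \<inter> {z. reg_energy A B c z \<le> 1}"
    by (auto simp: well_def)
  also have "closed \<dots>"
    by (intro closed_Int closed_TS2 closed_Collect_le continuous_on_chart_radius continuous_on_reg_energy continuous_intros)
  finally show ?thesis .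
qed

lemma compact_shell: "compact shell"
proof -
  have "shell = TS2 \<inter> {z. chart_radius z \<le> \<rho>} \<inter> {z. reg_energy A B c z = 1}"
    by (auto simp: shell_def)
  also have "closed \<dots>"
    by (intro closed_Int closed_TS2 closed_Collect_le closed_Collect_eq continuous_on_chart_radius
        continuous_on_reg_energy continuous_intros)
  finally have "closed shell" .
  moreover have "shell \<subseteq> well" by (auto simp: shell_def well_def)
  ultimately show ?thesis
    using bounded_subset[OF bounded_well] compact_eq_bounded_closed by blast
qed

lemma snd_shell_neq_0: "z \<in> shell \<Longrightarrow> snd z \<noteq> 0"
  by (auto simp: shell_def reg_energy_def chart_radius_def)

text \<open>Each ray meets the shell exactly once, so radial projection is a continuous bijection from a
compact set onto the unit bundle.  Compactness makes its inverse continuous, which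
spares the implicit function theorem.\<close>

lemma homeomorphism_unit_bundle_shell:
  "\<exists>g. homeomorphism unit_bundle shell g (\<lambda>z. (fst z, snd z /\<^sub>R norm (snd z)))
     \<and> (\<forall>z\<in>unit_bundle. fst (g z) = fst z)"
proof -
  define n :: "(real^3) \<times> (real^3) \<Rightarrow> (real^3) \<times> (real^3)"
    where "n z = (fst z, snd z /\<^sub>R norm (snd z))" for z
  have cont: "continuous_on shell n"
    unfolding n_def using snd_shell_neq_0 by (auto intro!: continuous_intros)
  have "n ` shell = unit_bundle"
  proof
    show "n ` shell \<subseteq> unit_bundle"
      using snd_shell_neq_0 by (auto simp: n_def unit_bundle_def shell_def TS2_def)
    show "unit_bundle \<subseteq> n ` shell"
    proof
      fix z assume "z \<in> unit_bundle"
      moreover obtain x u where z: "z = (x, u)" by fastforce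
      ultimately have "(x, u) \<in> TS2" "norm u = 1" by (auto simp: unit_bundle_def)
      moreover from this obtain t where "t > 0" "(x, t *\<^sub>R u) \<in> shell"
        using ex_shell_on_ray[of x u] by force
      ultimately show "z \<in> n ` shell"
        by (intro image_eqI[of _ _ "(x, t *\<^sub>R u)"]) (simp_all add: n_def z)
    qed
  qed
  moreover have "inj_on n shell"
  proof (rule inj_onI)
    fix z z' assume zz: "z \<in> shell" "z' \<in> shell" and eq: "n z = n z'"
    obtain x \<eta> x' \<eta>' where z: "z = (x, \<eta>)" "z' = (x', \<eta>')" by fastforce
    define u where "u = \<eta> /\<^sub>R norm \<eta>"
    have nz: "\<eta> \<noteq> 0" "\<eta>' \<noteq> 0" using snd_shell_neq_0[OF zz(1)] snd_shell_neq_0[OF zz(2)] z by auto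
    have u': "u = \<eta>' /\<^sub>R norm \<eta>'" and x: "x' = x"
      using eq by (auto simp: n_def z u_def)
    have *: "\<eta> = norm \<eta> *\<^sub>R u" "norm \<eta> > 0" using nz by (simp_all add: u_def)
    have *: "\<eta>' = norm \<eta>' *\<^sub>R u" "norm \<eta>' > 0" "\<eta> = norm \<eta> *\<^sub>R u" "norm \<eta> > 0"
      using nz * by (simp_all add: u')
    have "(x, u) \<in> TS2" using zz TS2_scale by (auto simp: shell_def z u_def)
    then have "norm \<eta> = norm \<eta>'"
      using shell_unique_on_ray[of x "norm \<eta>" u "norm \<eta>'"] zz * x z by simp
    then show "z = z'" using * z x by metis
  qed
  ultimately obtain g where g: "homeomorphism shell unit_bundle n g"
    using homeomorphism_compact[OF compact_shell cont] by blast
  have "fst (g z) = fst z" if "z \<in> unit_bundle" for z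
    using homeomorphism_apply2[OF g that] by (metis fst_conv n_def)
  then show ?thesis
    using homeomorphism_symD[OF g] unfolding n_def by blast
qed

lemma connected_shell: "connected shell"
proof -
  obtain g where h: "homeomorphism unit_bundle shell g (\<lambda>z. (fst z, snd z /\<^sub>R norm (snd z)))"
    using homeomorphism_unit_bundle_shell by blast
  then show ?thesis
    using connected_continuous_image[OF homeomorphism_cont1[OF h] connected_unit_bundle]
    by (simp add: homeomorphism_image1)
qed

lemma unit_bundle_nonempty: "unit_bundle \<noteq> {}"
proof -
  have "(axis 1 1, axis 2 1) \<in> unit_bundle" by (simp add: unit_bundle_iff inner_axis_axis)
  then show ?thesis by blast
qed

lemma shell_nonempty: "shell \<noteq> {}"
proof -
  obtain g where "homeomorphism unit_bundle shell g (\<lambda>z. (fst z, snd z /\<^sub>R norm (snd z)))"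
    using homeomorphism_unit_bundle_shell by blast
  then show ?thesis using homeomorphism_image1 unit_bundle_nonempty by blast
qed

end

section \<open>The regularized level and its bounded component\<close>

text \<open>\<open>\<alpha> / t + \<beta> * t\<^sup>2\<close> is the value of \<open>eff A B\<close> at \<open>t *\<^sub>R q\<close>; its derivative is nonnegative for \<open>t \<ge> 1\<close> when
\<open>\<alpha> \<le> 2 * \<beta>\<close>.\<close>

lemma effective_potential_mono:
  fixes \<alpha> \<beta> t c :: real
  assumes "1 \<le> t" "c \<le> \<alpha> + \<beta>" "0 \<le> \<alpha>" "\<alpha> \<le> 2 * \<beta>"
  shows "c \<le> \<alpha> / t + \<beta> * t\<^sup>2"
proof -
  have "\<alpha> / t \<le> \<alpha>" using assms by (simp add: divide_le_eq mult_left_le_one_le mult_le_cancel_left1)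
  have "\<beta> * (t + 1) \<ge> \<beta> * 2" using assms by (intro mult_left_mono) auto
  then have "0 \<le> (t - 1) * (\<beta> * (t + 1) - \<alpha> / t)"
    using assms \<open>\<alpha> / t \<le> \<alpha>\<close> by (intro mult_nonneg_nonneg) auto
  also have "\<dots> = \<alpha> / t + \<beta> * t\<^sup>2 - (\<alpha> + \<beta>)"
    using assms by (simp add: field_simps power2_eq_square)
  finally show ?thesis using assms by linarith
qed

lemma component_within:
  fixes C :: "'a::topological_space set"
  assumes "C \<in> components X" "X \<subseteq> U \<union> V" "open U" "open V" "U \<inter> V \<inter> X = {}" "x \<in> C" "x \<in> U"
  shows "C \<subseteq> U"
proof -
  have "connected C" "C \<subseteq> X"
    using in_components_connected[OF assms(1)] in_components_subset[OF assms(1)] by auto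
  then have "U \<inter> C = {} \<or> V \<inter> C = {}"
    using connectedD[of C U V] assms by blast
  then show ?thesis using \<open>C \<subseteq> X\<close> assms by blast
qed

context tidal_well
begin

abbreviation level :: "((real^3) \<times> (real^3)) set" where
  "level \<equiv> {z \<in> TS2. reg_energy A B c z = 1}"

lemma chart_level:
  "(Phi \<circ> Psi) ` {(q, p). q \<noteq> 0 \<and> tidal A B q p = - c} = {z \<in> level. fst z $ 3 \<noteq> 1}"
  unfolding Phi_Psi_eq
proof
  show "to_sphere ` {(q, p). q \<noteq> 0 \<and> tidal A B q p = - c} \<subseteq> {z \<in> level. fst z $ 3 \<noteq> 1}"
    using to_sphere_in_TS2 to_sphere_nth_3_neq by (auto simp: reg_energy_to_sphere)
  show "{z \<in> level. fst z $ 3 \<noteq> 1} \<subseteq> to_sphere ` {(q, p). q \<noteq> 0 \<and> tidal A B q p = - c}"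
  proof
    fix z assume "z \<in> {z \<in> level. fst z $ 3 \<noteq> 1}"
    then have z: "z \<in> TS2" "reg_energy A B c z = 1" "fst z $ 3 \<noteq> 1" by auto
    let ?q = "chart_pos z" and ?p = "chart_mom z"
    have eq: "to_sphere (?q, ?p) = z" using z by (intro to_sphere_chart)
    have "snd z \<noteq> 0" using z(2) by (auto simp: reg_energy_def chart_radius_def)
    then have "norm ?q \<noteq> 0" using z norm_chart_pos[OF z(1)] by (simp add: chart_radius_def)
    then have q: "?q \<noteq> 0" by simp
    have "norm ?q * (tidal A B ?q ?p + c) = 0"
      using reg_energy_to_sphere[OF q, of A B c ?p] z by (simp add: eq)
    then have "tidal A B ?q ?p = - c" using q by simp
    then show "z \<in> to_sphere ` {(q, p). q \<noteq> 0 \<and> tidal A B q p = - c}"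
      using q eq by (intro image_eqI[of _ _ "(?q, ?p)"]) auto
  qed
qed

text \<open>Taking the closure adds exactly the unit covectors over the north pole.  That each of
them is a limit is transported from the unit bundle by the homeomorphism.\<close>

lemma regularized_level_eq: "regularized_level (tidal A B) c = level"
  unfolding regularized_level_def chart_level
proof
  have "level = TS2 \<inter> {z. reg_energy A B c z = 1}" by auto
  also have "closed \<dots>"
    by (intro closed_Int closed_TS2 closed_Collect_eq continuous_on_reg_energy continuous_intros)
  finally show "closure {z \<in> level. fst z $ 3 \<noteq> 1} \<subseteq> level"
    by (rule closure_minimal[rotated]) auto
  show "level \<subseteq> closure {z \<in> level. fst z $ 3 \<noteq> 1}"
  proof
    fix z assume z: "z \<in> level"
    show "z \<in> closure {z \<in> level. fst z $ 3 \<noteq> 1}"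
    proof (cases "fst z $ 3 = 1")
      case False
      then show ?thesis using z by (intro subsetD[OF closure_subset]) auto
    next
      case True
      obtain g where g: "homeomorphism unit_bundle shell g (\<lambda>z. (fst z, snd z /\<^sub>R norm (snd z)))"
        and fst_g: "\<forall>z\<in>unit_bundle. fst (g z) = fst z"
        using homeomorphism_unit_bundle_shell by blast
      let ?U = "{z \<in> unit_bundle. fst z $ 3 \<noteq> 1}"
      have "unit_bundle = TS2 \<inter> {z. norm (snd z) = 1}" by (auto simp: unit_bundle_def)
      also have "closed \<dots>"
        by (intro closed_Int closed_TS2 closed_Collect_eq continuous_intros)
      finally have "closure ?U \<subseteq> unit_bundle" by (intro closure_minimal) auto
      then have cl: "closure ?U = unit_bundle" using unit_bundle_subset_closure by auto
      have "z \<in> shell" using z True \<rho> by (auto simp: shell_def chart_radius_def)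
      then have "z \<in> g ` closure ?U" using homeomorphism_image1[OF g] by (simp add: cl)
      also have "\<dots> \<subseteq> closure {z \<in> level. fst z $ 3 \<noteq> 1}"
      proof (rule image_closure_subset)
        show "continuous_on (closure ?U) g" unfolding cl by (rule homeomorphism_cont1[OF g])
        have "g w \<in> shell" if "w \<in> unit_bundle" for w using homeomorphism_image1[OF g] that by auto
        then have "g ` ?U \<subseteq> {z \<in> level. fst z $ 3 \<noteq> 1}"
          using fst_g by (auto simp: shell_def)
        then show "g ` ?U \<subseteq> closure {z \<in> level. fst z $ 3 \<noteq> 1}"
          using closure_subset by blast
      qed simp
      finally show ?thesis .
    qed
  qed
qed

text \<open>Outside the barrier the Hill region is closed under scaling by \<open>t \<ge> 1\<close>.  A point of the level there
moves to infinity inside the level if \<open>q\<close> is scaled, the direction \<open>e\<close> of the kinetic momentum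
\<open>p - (- q\<^sub>2, q\<^sub>1)\<close> is kept and its length is adjusted to the energy.  Hence no component outside the
barrier is bounded.\<close>

lemma outer_level_unbounded:
  assumes z: "z \<in> level" "\<rho> < chart_radius z"
  shows "\<exists>C. connected C \<and> z \<in> C \<and> C \<subseteq> level \<and> \<not> bounded C"
proof -
  let ?x3 = "fst z $ 3"
  have "?x3 \<noteq> 1" using z \<rho> by (auto simp: chart_radius_def)
  then have "z \<in> (Phi \<circ> Psi) ` {(q, p). q \<noteq> 0 \<and> tidal A B q p = - c}"
    unfolding chart_level using z by auto
  then obtain q p where q: "q \<noteq> 0" and H: "tidal A B q p = - c" and zqp: "z = to_sphere (q, p)"
    by (auto simp: Phi_Psi_eq)
  have nq: "\<rho> < norm q" using z by (simp add: zqp chart_radius_to_sphere)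
  define J :: "real^2 \<Rightarrow> real^2" where "J v = vector [- v$2, v$1]" for v
  define \<alpha> \<beta> where "\<alpha> = 1 / norm q" and "\<beta> = (1/2 - A) * (q$1)\<^sup>2 + (1/2 - B) * (q$2)\<^sup>2"
  have eff_t: "eff A B (t *\<^sub>R q) = \<alpha> / t + \<beta> * t\<^sup>2" if "1 \<le> t" for t
    using that by (simp add: eff_def \<alpha>_def \<beta>_def power_mult_distrib algebra_simps)
  have "(norm (p - J q))\<^sup>2 / 2 - eff A B q = - c"
    using H unfolding tidal_eq norm2_sq by (simp add: J_def)
  then have kin: "(norm (p - J q))\<^sup>2 = 2 * (eff A B q - c)" by simp
  have "0 \<le> 2 * (eff A B q - c)" unfolding kin[symmetric] by simp
  then have c1: "c \<le> \<alpha> + \<beta>" using eff_t[of 1] by simp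
  \<comment> \<open>\<open>\<alpha> < 2 * c / 3\<close> and \<open>c \<le> \<alpha> + \<beta>\<close> give \<open>\<beta> > c / 3 > \<alpha> / 2\<close>\<close>
  have "\<alpha> < 1 / \<rho>" using nq \<rho> by (simp add: \<alpha>_def frac_less2)
  also have "\<dots> < 2 * c / 3" using above \<rho> by (simp add: field_simps)
  finally have c2: "\<alpha> \<le> 2 * \<beta>" using c1 by simp
  have "\<alpha> \<ge> 0" by (simp add: \<alpha>_def)
  then have ge: "c \<le> \<alpha> / t + \<beta> * t\<^sup>2" if "1 \<le> t" for t
    using effective_potential_mono c1 c2 that by blast
  obtain e where e: "norm e = 1" "p - J q = norm (p - J q) *\<^sub>R e"
  proof (cases "p - J q = 0")
    case True
    then show ?thesis using that[of "axis 1 1"] by simp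
  next
    case False
    then show ?thesis using that[of "(p - J q) /\<^sub>R norm (p - J q)"] by simp
  qed
  define P where "P t = J (t *\<^sub>R q) + sqrt (2 * (\<alpha> / t + \<beta> * t\<^sup>2 - c)) *\<^sub>R e" for t
  define \<gamma> where "\<gamma> t = to_sphere (t *\<^sub>R q, P t)" for t
  have "continuous_on {1..} (\<lambda>t. (t *\<^sub>R q, P t))"
    unfolding P_def J_def vector_scaleR_component vec2_axis
    by (intro continuous_intros) auto
  then have "continuous_on {1..} \<gamma>"
    unfolding \<gamma>_def by (rule continuous_on_compose2[OF continuous_on_to_sphere]) auto
  then have "connected (\<gamma> ` {1..})"
    by (intro connected_continuous_image) auto
  moreover have "z \<in> \<gamma> ` {1..}"
  proof -
    have "sqrt (2 * (\<alpha> / 1 + \<beta> * 1\<^sup>2 - c)) = norm (p - J q)"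
      using kin eff_t[of 1] by (simp add: real_sqrt_unique)
    then have "P 1 = p" using e(2) unfolding P_def by (simp add: algebra_simps)
    then have "\<gamma> 1 = z" by (simp add: \<gamma>_def zqp)
    then show ?thesis by force
  qed
  moreover have "\<gamma> ` {1..} \<subseteq> level"
  proof
    fix y assume "y \<in> \<gamma> ` {1..}"
    then obtain t where t: "1 \<le> t" "y = \<gamma> t" by auto
    let ?s = "sqrt (2 * (\<alpha> / t + \<beta> * t\<^sup>2 - c))"
    have s2: "?s\<^sup>2 = 2 * (\<alpha> / t + \<beta> * t\<^sup>2 - c)" using ge[OF t(1)] by simp
    have "(P t$1 + (t *\<^sub>R q)$2)\<^sup>2 + (P t$2 - (t *\<^sub>R q)$1)\<^sup>2 = (norm (?s *\<^sub>R e))\<^sup>2"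
      unfolding norm2_sq P_def by (simp add: J_def)
    also have "\<dots> = 2 * (\<alpha> / t + \<beta> * t\<^sup>2 - c)" using e(1) s2 by (simp add: power_mult_distrib)
    finally have k: "(P t$1 + (t *\<^sub>R q)$2)\<^sup>2 + (P t$2 - (t *\<^sub>R q)$1)\<^sup>2 = 2 * (\<alpha> / t + \<beta> * t\<^sup>2 - c)" .
    have "2 * (X - c) / 2 - X = - c" for X :: real by (simp add: field_simps)
    then have "tidal A B (t *\<^sub>R q) (P t) = - c"
      unfolding tidal_eq eff_t[OF t(1)] k by blast
    moreover have "t *\<^sub>R q \<noteq> 0" using t q by simp
    ultimately show "y \<in> level"
      unfolding t \<gamma>_def using to_sphere_in_TS2 by (simp add: reg_energy_to_sphere)
  qed
  moreover have "\<not> bounded (\<gamma> ` {1..})"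
  proof
    assume "bounded (\<gamma> ` {1..})"
    then obtain M where M: "\<And>t. 1 \<le> t \<Longrightarrow> norm (\<gamma> t) \<le> M"
      unfolding bounded_iff by auto
    define t where "t = 1 + 2 * (\<bar>M\<bar> + 1) / norm q"
    have t: "1 \<le> t" by (simp add: t_def)
    have "t * norm q = norm q + 2 * (\<bar>M\<bar> + 1)" using q by (simp add: t_def field_simps)
    moreover have "M * 2 < norm q + (2 * \<bar>M\<bar> + 2)"
      using abs_ge_self[of M] norm_ge_zero[of q] by linarith
    ultimately have "M < t * norm q * 1 / 2" by simp
    also have "\<dots> \<le> t * norm q * ((norm (P t))\<^sup>2 + 1) / 2"
      using t by (intro divide_right_mono mult_left_mono) auto
    also have "\<dots> = norm (snd (\<gamma> t))"
      using t by (simp add: \<gamma>_def norm_snd_to_sphere)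
    also have "\<dots> \<le> norm (\<gamma> t)" by (metis norm_snd_le prod.collapse)
    finally show False using M[OF t] by simp
  qed
  ultimately show ?thesis by blast
qed

text \<open>No point of the level has \<open>|q| = \<rho>\<close>, so the connected shell is a whole component, and all other
components lie outside the barrier.\<close>

lemma hypersurface_eq: "hypersurface (tidal A B) c = shell"
proof -
  let ?U = "{z. chart_radius z < \<rho>}" and ?V = "{z. \<rho> < chart_radius z}"
  have op: "open ?U" "open ?V"
    by (intro open_Collect_less continuous_on_chart_radius continuous_intros)+
  have cover: "level \<subseteq> ?U \<union> ?V" using reg_energy_gt_1_on_barrier by force
  have disj: "?U \<inter> ?V \<inter> level = {}" by auto
  have shell: "shell = level \<inter> ?U" using chart_radius_lt by (force simp: shell_def)
  obtain x where x: "x \<in> shell" using shell_nonempty by blast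
  obtain C where C: "C \<in> components level" "shell \<subseteq> C"
    using exists_component_superset[of shell level] shell shell_nonempty connected_shell by blast
  have "C \<subseteq> ?U"
    using component_within[OF C(1) cover op disj, of x] x C(2) shell by blast
  then have "C = shell" using C in_components_subset[OF C(1)] shell by blast
  then have comp: "shell \<in> components level" using C by simp
  show ?thesis
    unfolding hypersurface_def regularized_level_eq
  proof (rule the_equality)
    show "shell \<in> components level \<and> bounded shell"
      using comp compact_imp_bounded[OF compact_shell] by simp
    fix C assume C: "C \<in> components level \<and> bounded C"
    then obtain y where y: "y \<in> C" "y \<in> level"
      using in_components_nonempty in_components_subset by blast
    show "C = shell"
    proof (cases "y \<in> ?U")
      case True
      then have "y \<in> shell" using y shell by blast
      then show ?thesis using components_nonoverlap[of C level shell] C comp y by blast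
    next
      case False
      then have "\<rho> < chart_radius y" using cover y by auto
      then obtain D where "connected D" "y \<in> D" "D \<subseteq> level" "\<not> bounded D"
        using outer_level_unbounded y(2) by blast
      moreover from this have "D \<subseteq> C"
        using components_maximal[of C level D] C y by blast
      ultimately show ?thesis using C bounded_subset by blast
    qed
  qed
qed

lemma outer_ray:
  assumes z: "(x, \<eta>) \<in> TS2 - well"
  shows "\<exists>C. connected C \<and> (x, \<eta>) \<in> C \<and> C \<subseteq> TS2 - shell \<and> \<not> bounded C"
proof (intro exI conjI)
  let ?C = "(\<lambda>t. (x, t *\<^sub>R \<eta>)) ` {1..}"
  show "connected ?C" by (intro connected_continuous_image continuous_intros) auto
  show "(x, \<eta>) \<in> ?C" by (rule image_eqI[of _ _ 1]) auto
  have T: "(x, \<eta>) \<in> TS2" using z by simp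
  show "?C \<subseteq> TS2 - shell"
  proof
    fix y assume "y \<in> ?C"
    then obtain t where y: "y = (x, t *\<^sub>R \<eta>)" and t: "t \<in> {1..}" by blast
    have "(x, t *\<^sub>R \<eta>) \<notin> shell"
    proof
      assume s: "(x, t *\<^sub>R \<eta>) \<in> shell"
      then have r: "t * chart_radius (x, \<eta>) \<le> \<rho>" and K: "reg_energy A B c (x, t *\<^sub>R \<eta>) = 1"
        using t by (auto simp: shell_def chart_radius_scale)
      have "1 * chart_radius (x, \<eta>) \<le> t * chart_radius (x, \<eta>)"
        using t chart_radius_nonneg[OF T] by (intro mult_right_mono) auto
      then have "chart_radius (x, \<eta>) \<le> \<rho>" using r by simp
      then have K1: "reg_energy A B c (x, \<eta>) > 1" using z by (auto simp: well_def)
      then have "t \<noteq> 1" using K by auto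
      then show False
        using reg_energy_gt_1_outward[OF T, of 1 t] t r K K1 by auto
    qed
    then show "y \<in> TS2 - shell" using TS2_scale[OF T] y by simp
  qed
  have "\<eta> \<noteq> 0" using z \<rho> by (auto simp: well_def chart_radius_def reg_energy_def)
  show "\<not> bounded ?C"
  proof
    assume "bounded ?C"
    then obtain M where M: "\<And>t. 1 \<le> t \<Longrightarrow> norm (x, t *\<^sub>R \<eta>) \<le> M"
      unfolding bounded_iff by auto
    define t where "t = 1 + \<bar>M\<bar> / norm \<eta>"
    have t: "1 \<le> t" by (simp add: t_def)
    have "t * norm \<eta> = norm \<eta> + \<bar>M\<bar>" using \<open>\<eta> \<noteq> 0\<close> by (simp add: t_def field_simps)
    then have "M < t * norm \<eta>" using \<open>\<eta> \<noteq> 0\<close> norm_ge_zero[of \<eta>] zero_less_norm_iff[of \<eta>] by linarith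
    also have "\<dots> = norm (t *\<^sub>R \<eta>)" using t by simp
    also have "\<dots> \<le> norm (x, t *\<^sub>R \<eta>)" by (rule norm_snd_le)
    finally show False using M[OF t] by simp
  qed
qed

text \<open>The complement of the shell splits into the bounded open part of the well and the rest, and from
every point of the rest a ray leads to infinity.\<close>

lemma bounded_domain_eq: "bounded_domain (hypersurface (tidal A B) c) = well"
  unfolding hypersurface_eq bounded_domain_def
proof
  let ?U = "{z. chart_radius z < \<rho> \<and> reg_energy A B c z < 1}" and ?V = "{z. \<rho> < chart_radius z \<or> 1 < reg_energy A B c z}"
  have op: "open ?U" "open ?V"
    by (intro open_Collect_conj open_Collect_disj open_Collect_less continuous_on_chart_radius
        continuous_on_reg_energy continuous_intros)+
  have cover: "TS2 - shell \<subseteq> ?U \<union> ?V" using reg_energy_gt_1_on_barrier by (force simp: shell_def)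
  have disj: "?U \<inter> ?V \<inter> (TS2 - shell) = {}" by auto
  show "well \<subseteq> shell \<union> \<Union> {C \<in> components (TS2 - shell). bounded C}"
  proof
    fix z assume z: "z \<in> well"
    show "z \<in> shell \<union> \<Union> {C \<in> components (TS2 - shell). bounded C}"
    proof (cases "z \<in> shell")
      case False
      then have zT: "z \<in> TS2 - shell" using z by (auto simp: well_def)
      then obtain C where C: "C \<in> components (TS2 - shell)" "z \<in> C"
        using Union_components[of "TS2 - shell"] by blast
      have "z \<in> ?U" using zT z cover by (auto simp: well_def)
      then have "C \<subseteq> ?U" using component_within[OF C(1) cover op disj C(2)] by blast
      then have "C \<subseteq> well" using in_components_subset[OF C(1)] by (auto simp: well_def)
      then have "bounded C" using bounded_well bounded_subset by blast
      then show ?thesis using C by blast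
    qed simp
  qed
  have "C \<subseteq> well" if C: "C \<in> components (TS2 - shell)" "bounded C" for C
  proof
    fix z assume z: "z \<in> C"
    show "z \<in> well"
    proof (rule ccontr)
      assume "z \<notin> well"
      moreover have "z \<in> TS2" using in_components_subset[OF C(1)] z by auto
      ultimately obtain D where "connected D" "z \<in> D" "D \<subseteq> TS2 - shell" "\<not> bounded D"
        using outer_ray[of "fst z" "snd z"] by auto
      moreover from this have "D \<subseteq> C"
        using components_maximal[of C "TS2 - shell" D] C z by blast
      ultimately show False using C bounded_subset by blast
    qed
  qed
  then show "shell \<union> \<Union> {C \<in> components (TS2 - shell). bounded C} \<subseteq> well"
    by (auto simp: shell_def well_def)
qed

end

section \<open>Comparing the two problems\<close>

context tidal_well
begin

lemma tidal_le_on_well: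
  assumes "to_sphere (q, p) \<in> well" "q \<noteq> 0"
  shows "norm q \<le> \<rho>" "tidal A B q p \<le> - c"
proof -
  show "norm q \<le> \<rho>" using assms(1) by (simp add: well_def chart_radius_to_sphere)
  have "norm q * (tidal A B q p + c) \<le> 0"
    using assms by (simp add: well_def reg_energy_to_sphere)
  then show "tidal A B q p \<le> - c" using assms(2) by (simp add: mult_le_0_iff)
qed

end

text \<open>Inclusions of the domains reduce to inequalities between Hamiltonians in the chart: on the zero
section and over the north pole, where \<open>q = 0\<close>, both regularized energies are \<open>|\<eta>|\<close>.\<close>

lemma well_subset_well:
  assumes M: "tidal_well A B \<rho> c" and M': "tidal_well A' B' \<rho>' c'"
    and incl: "\<And>q p. \<lbrakk>q \<noteq> 0; norm q \<le> \<rho>; tidal A B q p \<le> - c\<rbrakk>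
      \<Longrightarrow> norm q \<le> \<rho>' \<and> tidal A' B' q p \<le> - c'"
  shows "tidal_well.well A B \<rho> c \<subseteq> tidal_well.well A' B' \<rho>' c'"
proof
  interpret M: tidal_well A B \<rho> c by fact
  interpret M': tidal_well A' B' \<rho>' c' by fact
  fix z assume z: "z \<in> M.well"
  then have T: "z \<in> TS2" and K: "reg_energy A B c z \<le> 1" by (auto simp: M.well_def)
  show "z \<in> M'.well"
  proof (cases "chart_radius z = 0")
    case True
    then show ?thesis using T K M'.\<rho> by (simp add: M'.well_def reg_energy_def)
  next
    case False
    let ?q = "chart_pos z" and ?p = "chart_mom z"
    have "fst z $ 3 \<noteq> 1" using False by (auto simp: chart_radius_def)
    then have eq: "to_sphere (?q, ?p) = z" using T by (intro to_sphere_chart)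
    have q: "?q \<noteq> 0" using norm_chart_pos[OF T] False by auto
    have "norm ?q \<le> \<rho>' \<and> tidal A' B' ?q ?p \<le> - c'"
      using M.tidal_le_on_well[of ?q ?p] z q by (intro incl) (auto simp: eq)
    moreover have "norm ?q * (tidal A' B' ?q ?p + c') \<le> 0"
      using calculation by (simp add: mult_nonneg_nonpos)
    ultimately show ?thesis
      using T reg_energy_to_sphere[OF q, of A' B' c' ?p] norm_chart_pos[OF T]
      by (simp add: M'.well_def eq)
  qed
qed

text \<open>The distance from the origin of the critical points of Hill's effective potential.\<close>

definition r_H :: real where "r_H = 1 / root 3 3"

lemma r_H_cube: "r_H ^ 3 = 1 / 3"
  by (simp add: r_H_def power_one_over)

lemma r_H_pos: "0 < r_H"
  by (simp add: r_H_def)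

lemma r_H_lt_1: "r_H < 1"
proof (rule ccontr)
  assume "\<not> r_H < 1"
  then have "1 \<le> r_H ^ 3" using one_le_power[of r_H 3] by simp
  then show False by (simp add: r_H_cube)
qed

lemma c_H0_eq: "c_H0 = 3 / (2 * r_H)"
proof -
  have "(3::real) powr (4/3) = 3 powr 1 * 3 powr (1/3)"
    unfolding powr_add[symmetric] by simp
  also have "(3::real) powr (1/3) = root 3 3"
    using root_powr_inverse[of 3 3] by simp
  finally show ?thesis by (simp add: c_H0_def r_H_def)
qed

lemma tidal_well_R: "3 / 2 < c \<Longrightarrow> tidal_well 0 0 1 c"
  by unfold_locales auto

lemma tidal_well_H: "c_H0 < c \<Longrightarrow> tidal_well (-1) (1/2) r_H c"
  using r_H_pos r_H_lt_1 by unfold_locales (auto simp: r_H_cube c_H0_eq field_simps)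

lemma M_R_eq: "3 / 2 < c \<Longrightarrow> M_R c = tidal_well.well 0 0 1 c"
  unfolding M_R_def H_R_eq_tidal by (rule tidal_well.bounded_domain_eq[OF tidal_well_R])

lemma M_H_eq: "c_H0 < c \<Longrightarrow> M_H c = tidal_well.well (-1) (1/2) r_H c"
  unfolding M_H_def H_H_eq_tidal using tidal_well.bounded_domain_eq[OF tidal_well_H] by simp

lemma M_H_crit: "M_H c_H0 = closure (\<Union>c\<in>{c_H0<..}. M_H c)"
  by (simp add: M_H_def)

lemma eff_H_bound: "norm q = s \<Longrightarrow> eff (-1) (1/2) q \<le> 1 / s + 3/2 * s\<^sup>2"
  using norm2_sq[of q] by (simp add: eff_def)

lemma eff_R_eq: "norm q = s \<Longrightarrow> eff 0 0 q = 1 / s + s\<^sup>2 / 2"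
  using norm2_sq[of q] by (simp add: eff_def add_divide_distrib)

lemma tidal_H_R: "tidal 0 0 q p = tidal (-1) (1/2) q p + (q$1)\<^sup>2 - (q$2)\<^sup>2 / 2"
  by (simp add: tidal_def)

text \<open>The derivative \<open>- 1 / t\<^sup>2 + 2 * m * t\<close> is negative as long as \<open>2 * m * t ^ 3 < 1\<close>.\<close>

lemma inverse_plus_square_strict_antimono:
  fixes m s t :: real
  assumes "0 < s" "s < t" "2 * m * t ^ 3 \<le> 1" "0 \<le> m"
  shows "1 / t + m * t\<^sup>2 < 1 / s + m * s\<^sup>2"
proof -
  have t: "0 < t" using assms by linarith
  have "s * t * (s + t) < t * t * (t + t)"
    using assms t by (intro mult_strict_mono' mult_strict_right_mono) auto
  then have "m * (s * t * (s + t)) \<le> m * (t * t * (t + t))" (is "?l \<le> ?r")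
    using assms by (intro mult_left_mono) auto
  have "?l < 1"
  proof (cases "m = 0")
    case False
    then have "?l < ?r" using \<open>s * t * (s + t) < t * t * (t + t)\<close> assms by simp
    then show ?thesis using assms by (simp add: power3_eq_cube)
  qed simp
  then have "0 < (t - s) * (1 - ?l)" using assms by simp
  also have "\<dots> = s * t * (1 / s + m * s\<^sup>2 - (1 / t + m * t\<^sup>2))"
    using assms t by (simp add: field_simps power2_eq_square power3_eq_cube)
  finally have "0 < s * t * (1 / s + m * s\<^sup>2 - (1 / t + m * t\<^sup>2))" .
  then have "0 < 1 / s + m * s\<^sup>2 - (1 / t + m * t\<^sup>2)"
    by (rule zero_less_mult_pos) (use assms t in simp)
  then show ?thesis by simp
qed

text \<open>Since \<open>c + 1 / (2 * c\<^sup>2)\<close> is the value of \<open>1 / s + s\<^sup>2 / 2\<close> at \<open>s = 1 / c\<close>, the bounded part of the Hill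
region of the rotating Kepler problem is the disc \<open>|q| \<le> 1 / c\<close>.  There the two Hamiltonians differ by
\<open>q\<^sub>2\<^sup>2 / 2 - q\<^sub>1\<^sup>2 \<le> 1 / (2 * c\<^sup>2)\<close>.\<close>

lemma M_R_subset_M_H:
  assumes c: "c_H0 < c"
  shows "M_R (c + 1 / (2 * c\<^sup>2)) \<subseteq> M_H c"
proof -
  let ?c' = "c + 1 / (2 * c\<^sup>2)"
  have "3 / 2 < c_H0" using r_H_pos r_H_lt_1 by (simp add: c_H0_eq field_simps)
  then have c1: "3 / 2 < c" using c by simp
  then have c': "3 / 2 < ?c'" by (smt (verit) divide_nonneg_nonneg zero_le_power2)
  have c_r: "1 / c \<le> r_H"
    using c r_H_pos c1 by (simp add: c_H0_eq field_simps)
  show ?thesis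
    unfolding M_R_eq[OF c'] M_H_eq[OF c]
  proof (rule well_subset_well[OF tidal_well_R[OF c'] tidal_well_H[OF c]])
    fix q p :: "real^2"
    assume q: "q \<noteq> 0" "norm q \<le> 1" and H: "tidal 0 0 q p \<le> - ?c'"
    define s where "s = norm q"
    have s: "0 < s" "s \<le> 1" using q by (simp_all add: s_def)
    have W: "?c' \<le> 1 / s + s\<^sup>2 / 2"
      using H tidal_ge[of 0 0 q p] eff_R_eq[of q s] by (simp add: s_def)
    have sc: "s \<le> 1 / c"
    proof (rule ccontr)
      assume "\<not> s \<le> 1 / c"
      then have "1 / s + 1/2 * s\<^sup>2 < 1 / (1 / c) + 1/2 * (1 / c)\<^sup>2"
        using c1 s by (intro inverse_plus_square_strict_antimono) (auto simp: power_le_one)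
      then show False using W by (simp add: power_one_over)
    qed
    have "(q$2)\<^sup>2 \<le> s\<^sup>2" using norm2_sq[of q] by (simp add: s_def)
    also have "\<dots> \<le> (1 / c)\<^sup>2" using sc s by (intro power_mono) auto
    finally have "(q$2)\<^sup>2 / 2 \<le> 1 / (2 * c\<^sup>2)" by (simp add: power_one_over)
    then have "tidal (-1) (1/2) q p \<le> - c"
      using H tidal_H_R[of q p] zero_le_power2[of "q$1"] by linarith
    then show "norm q \<le> r_H \<and> tidal (-1) (1/2) q p \<le> - c"
      using sc c_r by (simp add: s_def)
  qed
qed

text \<open>In terms of \<open>s = |q|\<close>, the hypothesis says that \<open>s\<^sup>2 \<le> c - c'\<close> for the radii that occur in the bounded part
of Hill's region, and \<open>s\<^sup>2\<close> bounds the difference \<open>q\<^sub>1\<^sup>2 - q\<^sub>2\<^sup>2 / 2\<close> of the Hamiltonians.\<close>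

lemma M_H_subset_M_R:
  assumes c: "c_H0 < c" and c': "3 / 2 < c'"
    and bound: "\<And>s. \<lbrakk>0 < s; s \<le> r_H; c \<le> 1 / s + 3/2 * s\<^sup>2\<rbrakk> \<Longrightarrow> c' + s\<^sup>2 \<le> c"
  shows "M_H c \<subseteq> M_R c'"
  unfolding M_R_eq[OF c'] M_H_eq[OF c]
proof (rule well_subset_well[OF tidal_well_H[OF c] tidal_well_R[OF c']])
  fix q p :: "real^2"
  assume q: "q \<noteq> 0" "norm q \<le> r_H" and H: "tidal (-1) (1/2) q p \<le> - c"
  have "c \<le> 1 / norm q + 3/2 * (norm q)\<^sup>2"
    using H tidal_ge[of "-1" "1/2" q p] eff_H_bound[of q "norm q"] by simp
  then have "c' + (norm q)\<^sup>2 \<le> c" using q by (intro bound) auto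
  moreover have "(q$1)\<^sup>2 \<le> (norm q)\<^sup>2" by (simp add: norm2_sq)
  ultimately have "tidal 0 0 q p \<le> - c'"
    using H tidal_H_R[of q p] zero_le_power2[of "q$2"] by linarith
  then show "norm q \<le> 1 \<and> tidal 0 0 q p \<le> - c'"
    using q r_H_lt_1 by simp
qed

text \<open>With \<open>k ^ 3 = P + 1\<close> this is \<open>k ^ 3 + 2 - 3 * k = (k - 1)\<^sup>2 * (k + 2) > 0\<close>.\<close>

lemma c_R_gt:
  assumes "1 \<le> P"
  shows "3 / 2 < c_R P"
proof -
  define k where "k = root 3 (real P + 1)"
  have k3: "k ^ 3 = real P + 1" by (simp add: k_def)
  have k: "1 < k" using assms by (simp add: k_def)
  have "0 < (k - 1)\<^sup>2 * (k + 2)" using k by simp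
  also have "\<dots> = k ^ 3 + 2 - 3 * k" by (simp add: power2_eq_square power3_eq_cube algebra_simps)
  finally have "3 * k < real P + 3" by (simp add: k3)
  then show ?thesis using k unfolding c_R_def k_def[symmetric] by (simp add: field_simps)
qed

text \<open>With \<open>k ^ 3 = 2\<close> one has \<open>c_R 1 = k\<^sup>2\<close>, and \<open>c_H0 = 9/2 * r_H\<^sup>2\<close>; the claim \<open>k\<^sup>2 \<le> 7/2 * r_H\<^sup>2\<close> is
\<open>4 \<le> 343 / 72\<close> after cubing.\<close>

lemma c_R_1_le: "c_R 1 + r_H\<^sup>2 \<le> c_H0"
proof -
  define k where "k = root 3 (2::real)"
  have k3: "k ^ 3 = 2" and k: "0 < k" by (simp_all add: k_def)
  have k2: "k\<^sup>2 * k = 2" using k3 by (simp add: power2_eq_square power3_eq_cube)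
  have 1: "c_R 1 = k\<^sup>2"
    using k k2 unfolding c_R_def by (simp add: divide_eq_eq flip: k_def)
  have 2: "c_H0 = 9/2 * r_H\<^sup>2"
    using r_H_cube r_H_pos unfolding c_H0_eq by (simp add: field_simps power2_eq_square power3_eq_cube)
  have "(k\<^sup>2) ^ 3 = (k ^ 3)\<^sup>2" "(r_H\<^sup>2) ^ 3 = (r_H ^ 3)\<^sup>2"
    by (simp_all flip: power_mult)
  then have "(k\<^sup>2) ^ 3 \<le> (7/2 * r_H\<^sup>2) ^ 3"
    by (simp only: power_mult_distrib k3 r_H_cube) (simp add: power2_eq_square power3_eq_cube)
  then have "k\<^sup>2 \<le> 7/2 * r_H\<^sup>2"
    by (subst (asm) power_mono_iff) auto
  then show ?thesis using 1 2 by simp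
qed

text \<open>The point where the comparison is sharp.  Put \<open>k ^ 3 = P + 1\<close> and let \<open>x\<close> be the positive root of
\<open>k * x * (x + k) = 2\<close>.  Then \<open>c_R P = 1 / x + x\<^sup>2 / 2\<close> and \<open>c_H P = 1 / x + 3/2 * x\<^sup>2\<close>, so \<open>(x, 0)\<close> lies on the
boundary of the Hill regions of both problems at these energies.  The root lies inside the critical
radius because \<open>P \<ge> 2\<close>, that is, \<open>k * r_H \<ge> 1\<close>; for \<open>P = 1\<close> it lies outside.\<close>

lemma c_H_attained_at_radius:
  assumes "2 \<le> P"
  obtains x where "0 < x" "x < r_H" "c_H P = 1 / x + 3/2 * x\<^sup>2" "c_R P + x\<^sup>2 = c_H P"
proof -
  define k where "k = root 3 (real P + 1)"
  have k3: "k ^ 3 = real P + 1" by (simp add: k_def)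
  have k: "1 < k" using assms by (simp add: k_def)
  define w where "w = sqrt (k\<^sup>2 + 8 / k)"
  have "0 < k\<^sup>2 + 8 / k" using k by (simp add: add_pos_pos)
  then have w2: "w\<^sup>2 = k\<^sup>2 + 8 / k" and w0: "0 < w" by (simp_all add: w_def)
  have "k\<^sup>2 < w\<^sup>2" unfolding w2 using k by simp
  then have kw: "k < w" using w0 by (simp add: power2_less_imp_less)
  define x where "x = (w - k) / 2"
  have x: "0 < x" using kw by (simp add: x_def)
  have w: "w = 2 * x + k" by (simp add: x_def field_simps)
  have "k * w\<^sup>2 = k * k\<^sup>2 + 8" unfolding w2 using k by (simp add: distrib_left)
  then have rel: "k * x * (x + k) = 2"
    unfolding w by (simp add: power2_eq_square algebra_simps)
  have ix: "1 / x = k * (x + k) / 2" and ik: "1 / k = x * (x + k) / 2"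
    using rel x k by (simp_all add: field_simps)
  have "(real P + 1) * (real P + 9) = k ^ 3 * (k ^ 3 + 8)" by (simp add: k3)
  also have "\<dots> = (k\<^sup>2 * w)\<^sup>2"
    unfolding power_mult_distrib w2 using k by (simp add: field_simps power2_eq_square power3_eq_cube)
  finally have sq: "sqrt ((real P + 1) * (real P + 9)) = k\<^sup>2 * w"
    using w0 by simp
  have R: "c_R P = k\<^sup>2 / 2 + 1 / k"
  proof -
    have "c_R P = (k ^ 3 + 2) / (2 * k)" unfolding k3 c_R_def k_def[symmetric] by simp
    then show ?thesis using k by (simp add: field_simps power2_eq_square power3_eq_cube)
  qed
  have H: "c_H P = k\<^sup>2 / 2 + 3 * (1 / k) - k * x"
  proof -
    have "c_H P = (2 * k ^ 3 + 6 - k\<^sup>2 * w) / (2 * k)"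
      unfolding k3 c_H_def sq k_def[symmetric] by simp
    then show ?thesis using k by (simp add: w field_simps power2_eq_square power3_eq_cube)
  qed
  have c1: "c_R P + x\<^sup>2 = c_H P"
    unfolding R H ik by (simp add: field_simps power2_eq_square)
  have c2: "c_H P = 1 / x + 3/2 * x\<^sup>2"
    unfolding H ik ix by (simp add: field_simps power2_eq_square)
  have "x < r_H"
  proof (rule ccontr)
    assume "\<not> x < r_H"
    then have xr: "r_H \<le> x" by simp
    have "root 3 3 \<le> k" using assms by (simp add: k_def)
    then have kr: "1 / r_H \<le> k" by (simp add: r_H_def)
    then have kr1: "1 \<le> k * r_H" using r_H_pos by (simp add: field_simps)
    have "r_H + 1 / r_H \<le> x + k" using xr kr by simp
    also have "\<dots> = 1 * (x + k)" by simp
    also have "\<dots> \<le> k * x * (x + k)"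
    proof (rule mult_right_mono)
      have "k * r_H \<le> k * x" using xr k by simp
      then show "1 \<le> k * x" using kr1 by simp
    qed (use x k in simp)
    finally have "r_H + 1 / r_H \<le> 2" unfolding rel .
    then have "(1 - r_H)\<^sup>2 \<le> 0" using r_H_pos by (simp add: field_simps power2_eq_square)
    then show False using r_H_lt_1 by simp
  qed
  then show ?thesis using that x c1 c2 by blast
qed

lemma hill_potential_antimono:
  assumes "0 < s" "s < t" "t \<le> r_H"
  shows "1 / t + 3/2 * t\<^sup>2 < 1 / s + 3/2 * s\<^sup>2"
proof -
  have "t ^ 3 \<le> r_H ^ 3" using assms by (intro power_mono) auto
  then show ?thesis
    using assms by (intro inverse_plus_square_strict_antimono) (auto simp: r_H_cube)
qed

lemma c_H_gt:
  assumes "2 \<le> P"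
  shows "c_H0 < c_H P"
proof -
  obtain x where "0 < x" "x < r_H" "c_H P = 1 / x + 3/2 * x\<^sup>2"
    using c_H_attained_at_radius[OF assms] by blast
  moreover have "c_H0 = 1 / r_H + 3/2 * r_H\<^sup>2"
    using r_H_cube r_H_pos unfolding c_H0_eq by (simp add: field_simps power2_eq_square power3_eq_cube)
  ultimately show ?thesis using hill_potential_antimono[of x r_H] by simp
qed

text \<open>At an energy parameter \<open>c \<ge> c_H P\<close> the bounded part of Hill's region is contained in \<open>|q| \<le> x\<close>, with \<open>x\<close> as in
\<open>c_H_attained_at_radius\<close>.\<close>

lemma M_H_subset_M_R_c_R:
  assumes P: "2 \<le> P" and c: "c_H P \<le> c"
  shows "M_H c \<subseteq> M_R (c_R P)"
proof (rule M_H_subset_M_R)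
  show "c_H0 < c" using c_H_gt[OF P] c by simp
  show "3 / 2 < c_R P" using P by (intro c_R_gt) simp
  obtain x where x: "0 < x" "x < r_H" "c_H P = 1 / x + 3/2 * x\<^sup>2" "c_R P + x\<^sup>2 = c_H P"
    using c_H_attained_at_radius[OF P] by blast
  fix s assume s: "0 < s" "s \<le> r_H" "c \<le> 1 / s + 3/2 * s\<^sup>2"
  have "s \<le> x" using hill_potential_antimono[of x s] x s c by fastforce
  then have "s\<^sup>2 \<le> x\<^sup>2" using s by (intro power_mono) auto
  then show "c_R P + s\<^sup>2 \<le> c" using x c by simp
qed

text \<open>Here the crude bound \<open>|q| \<le> r_H\<close> suffices.  The limiting domain at \<open>c_H0\<close> is covered because \<open>M_R\<close> is
closed.\<close>

lemma M_H_subset_M_R_c_R_1: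
  assumes "c_H0 \<le> c"
  shows "M_H c \<subseteq> M_R (c_R 1)"
proof -
  have R: "3 / 2 < c_R 1" by (rule c_R_gt) simp
  have above: "M_H c \<subseteq> M_R (c_R 1)" if c: "c_H0 < c" for c
  proof (rule M_H_subset_M_R[OF c R])
    fix s assume "0 < s" "s \<le> r_H"
    then have "s\<^sup>2 \<le> r_H\<^sup>2" by (intro power_mono) auto
    then show "c_R 1 + s\<^sup>2 \<le> c" using c_R_1_le c by simp
  qed
  show ?thesis
  proof (cases "c = c_H0")
    case True
    have "closed (M_R (c_R 1))"
      unfolding M_R_eq[OF R] by (rule tidal_well.closed_well[OF tidal_well_R[OF R]])
    then show ?thesis
      unfolding True M_H_crit using above by (intro closure_minimal) auto
  qed (use above assms in simp)
qed

theorem theoremB: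
  shows "(\<forall>c\<ge>c_H0. M_H c \<subseteq> M_R (c_R 1)) \<and>
         (\<forall>P\<ge>2. \<forall>c\<ge>c_H P. M_H c \<subseteq> M_R (c_R P)) \<and>
         (\<forall>c>c_H0. M_R (c + 1 / (2 * c\<^sup>2)) \<subseteq> M_H c)"
  using M_H_subset_M_R_c_R_1 M_H_subset_M_R_c_R M_R_subset_M_H by blast

end
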